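(* Let $n,N$ be arbitrary positive integers and let $C,\eta>0$. Suppose $X_1,\dots,X_N$ are independent isotropic random vectors in $\mathbb{R}^n$ such that, for every $i$ and every orthogonal projection $P$ in $\mathbb{R}^n$, $$\mathbb{P}\{\|PX_i\|_2^2>t\}\le C\,t^{-1-\eta}\quad\text{for all } t>C\,\mathrm{rank}(P).$$ Let $y=n/N$. Then the sample covariance matrix $\Sigma_N=\frac1N\sum_{i=1}^N X_iX_i^T$ satisfies $$1-C_1y^c\le\mathbb{E}\lambda_{\min}(\Sigma_N)\le\mathbb{E}\lambda_{\max}(\Sigma_N)\le1+C_1(y+y^c),$$ where $c=\frac{\eta}{2\eta+2}$ and $C_1=512\,(16C)^{1+2/\eta}(6+6/\eta)^{1+4/\eta}$.
   Context: A random vector $X$ in $\mathbb{R}^n$ is isotropic if $\mathbb{E}XX^T=I$; it need not be centered. $\lambda_{\min}$ and $\lambda_{\max}$ denote the smallest and the largest eigenvalues of a symmetric matrix. $\|\cdot\|_2$ is the Euclidean norm. *)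

theory Defs
  imports "HOL-Probability.Probability"
begin

definition eigenvalues :: "real ^ 'n ^ 'n \<Rightarrow> real set" where
  "eigenvalues A = {l. \<exists>v. v \<noteq> 0 \<and> A *v v = l *\<^sub>R v}"

text \<open>The set of eigenvalues is always finite, and it is nonempty for a symmetric matrix; for
  a matrix without real eigenvalues the next two notions are unspecified.\<close>

definition lambda_min :: "real ^ 'n ^ 'n \<Rightarrow> real" where
  "lambda_min A = Min (eigenvalues A)"

definition lambda_max :: "real ^ 'n ^ 'n \<Rightarrow> real" where
  "lambda_max A = Max (eigenvalues A)"

definition orthogonal_projection :: "real ^ 'n ^ 'n \<Rightarrow> bool" where
  "orthogonal_projection P \<longleftrightarrow> P ** P = P \<and> transpose P = P"

text \<open>The rank-one matrix \<open>x x\<^sup>T\<close>.\<close>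

definition outer_square :: "real ^ 'n \<Rightarrow> real ^ 'n ^ 'n" where
  "outer_square x = (\<chi> i j. x $ i * x $ j)"

definition isotropic :: "'a measure \<Rightarrow> ('a \<Rightarrow> real ^ 'n) \<Rightarrow> bool" where
  "isotropic M X \<longleftrightarrow>
    integrable M (\<lambda>\<omega>. outer_square (X \<omega>)) \<and> (LINT \<omega>|M. outer_square (X \<omega>)) = mat 1"

definition sample_covariance :: "nat \<Rightarrow> (nat \<Rightarrow> 'a \<Rightarrow> real ^ 'n) \<Rightarrow> 'a \<Rightarrow> real ^ 'n ^ 'n" where
  "sample_covariance N X \<omega> = (1 / real N) *\<^sub>R (\<Sum>i = 1..N. outer_square (X i \<omega>))"

end

theory Submission
  imports Defs
begin

text \<open>
  The proof follows the barrier method of Batson, Spielman and Srivastava. The soft edge of a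
  symmetric matrix \<open>A\<close> is the point \<open>u\<close> to the right of its spectrum at which the trace of
  the inverse of \<open>u - A\<close> equals a small number \<open>\<phi>\<close>. It dominates the largest eigenvalue, and by the
  Sherman--Morrison formula adding \<open>X X\<^sup>T\<close> moves it by an amount that can be read off the
  coordinates of \<open>X\<close> in an eigenbasis of \<open>A\<close>. If the quadratic form \<open>q\<close> of the resolvent at \<open>X\<close> is
  small, the shift is essentially a weighted average of the squared coordinates, whose
  expectation is \<open>1\<close>. Otherwise some block of eigenvectors with comparable eigenvalues of
  \<open>u - A\<close> carries an unusually large part of \<open>X\<close>, and the tail assumption for the
  projection onto this block makes the expected additional shift at most \<open>\<epsilon> / 2\<close> when
  \<open>\<phi> = \<epsilon> powr (1 + 2 / \<eta>) / C\<^sub>1\<close>. Starting from \<open>A = 0\<close>, where the soft edge is \<open>n / \<phi>\<close>,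
  \<open>N\<close> steps give \<open>1 + \<epsilon> + y / \<phi>\<close> after normalization, and one optimizes over \<open>\<epsilon>\<close>. The smallest
  eigenvalue is treated by the same argument for the sums of \<open>- X X\<^sup>T\<close>.
\<close>

subsection \<open>Orthonormal eigenbases\<close>

text \<open>The obstacle is that the tail condition may give little more than a first moment, so the
  form \<open>q\<close> has no uniform bound, while an upward Sherman--Morrison update needs a shift
  that keeps \<open>q\<close> below 1. Blocks of ratio e resolve this: each gets a threshold, the
  thresholds sum to at most \<open>\<epsilon> / 8\<close>, and only overfull blocks cost more. Up to
  factors depending on \<open>C\<close> and \<eta>, the expected cost of these is
  \<open>\<epsilon> powr (- 1 - \<eta>) * \<phi> powr \<eta>\<close>; making it of order \<epsilon>
  forces \<phi> to be of order \<open>\<epsilon> powr (1 + 2 / \<eta>)\<close>. Balancing \<epsilon>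
  against \<open>y / \<phi>\<close> then yields the exponent \<open>c\<close>. For the smallest
  eigenvalue, subtracting a rank-one square never raises the soft edge, so a bad step is estimated
  by no movement at all. The soft edge and the extreme Rayleigh quotients are Lipschitz functions of
  the matrix, so their integrability follows from that of \<open>outer_square\<close>.\<close>

definition orthonormal :: "('n \<Rightarrow> real ^ 'n) \<Rightarrow> bool" where
  "orthonormal v \<longleftrightarrow> (\<forall>i j. v i \<bullet> v j = (if i = j then 1 else 0))"

lemma symmetric_inner:
  fixes A :: "real ^ 'n ^ 'n"
  assumes "transpose A = A"
  shows "x \<bullet> (A *v y) = (A *v x) \<bullet> y"
  by (metis assms dot_lmul_matrix vector_transpose_matrix)

text \<open>The first-order condition at a minimum in disguise: for small \<open>t\<close> of the
  sign opposite to \<open>b\<close>, the linear term would dominate and make the expression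
  negative.\<close>

lemma linear_coefficient_zero:
  fixes b c :: real
  assumes "\<And>t. 0 \<le> 2 * t * b + t\<^sup>2 * c"
  shows "b = 0"
proof (rule ccontr)
  assume b: "b \<noteq> 0"
  \<comment> \<open>Any positive \<open>k\<close> with \<open>c < 2 * k\<close> makes
    \<open>t = - b / k\<close> a point where the linear term wins.\<close>
  define k where "k = \<bar>c\<bar> + 1"
  have k: "k > 0" "c < 2 * k" unfolding k_def by auto
  have "2 * (- b / k) * b + (- b / k)\<^sup>2 * c = b\<^sup>2 / k\<^sup>2 * (c - 2 * k)"
    using k by (simp add: field_simps power2_eq_square)
  moreover have "b\<^sup>2 / k\<^sup>2 * (c - 2 * k) < 0"
    using b k by (intro mult_pos_neg) auto
  ultimately show False using assms[of "- b / k"] by simp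
qed

text \<open>A maximizer \<open>v\<close> of the quadratic form over the unit sphere of
  \<open>S\<close> works. Perturbing it inside \<open>S\<close> shows that
  \<open>l *\<^sub>R v - A *v v\<close> is orthogonal to \<open>S\<close>; by invariance this vector
  lies in \<open>S\<close>, so it vanishes.\<close>

lemma symmetric_invariant_subspace_eigenvector:
  fixes A :: "real ^ 'n ^ 'n"
  assumes sym: "transpose A = A" and S: "subspace S" "S \<noteq> {0}"
    and inv: "\<And>x. x \<in> S \<Longrightarrow> A *v x \<in> S"
  obtains v l where "v \<in> S" "norm v = 1" "A *v v = l *\<^sub>R v"
proof -
  let ?K = "S \<inter> sphere 0 1"
  obtain z where z: "z \<in> S" "z \<noteq> 0" using S subspace_0 by blast
  then have "(1 / norm z) *\<^sub>R z \<in> ?K" using S(1) by (auto intro: subspace_scale)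
  then have ne: "?K \<noteq> {}" by blast
  have comp: "compact ?K"
    using closed_subspace[OF S(1)] by (simp add: closed_Int_compact)
  have cont: "continuous_on ?K (\<lambda>x. x \<bullet> (A *v x))"
    by (intro continuous_intros linear_continuous_on) auto
  obtain v where v: "v \<in> ?K" and vmax: "\<And>x. x \<in> ?K \<Longrightarrow> x \<bullet> (A *v x) \<le> v \<bullet> (A *v v)"
    using continuous_attains_sup[OF comp ne cont] by blast
  define l where "l = v \<bullet> (A *v v)"
  have nv: "v \<bullet> v = 1" using v by (simp add: norm_eq_1)
  have le: "x \<bullet> (A *v x) \<le> l * (x \<bullet> x)" if "x \<in> S" for x
  proof (cases "x = 0")
    case False
    have "(1 / norm x) *\<^sub>R x \<in> ?K" using that False S(1) by (auto intro: subspace_scale)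
    from vmax[OF this] have "(x \<bullet> (A *v x)) / (norm x)\<^sup>2 \<le> l"
      by (simp add: l_def matrix_vector_mult_scaleR power2_eq_square)
    then show ?thesis using False by (simp add: pos_divide_le_eq power2_norm_eq_inner)
  qed simp
  \<comment> \<open>The polynomial in \<open>t\<close> is \<open>l\<close> times the squared norm of
    \<open>v + t *\<^sub>R w\<close> minus the quadratic form there; its constant term vanishes
    because \<open>v\<close> attains \<open>l\<close>.\<close>
  have "l * (v \<bullet> w) - w \<bullet> (A *v v) = 0" if w: "w \<in> S" for w
  proof (rule linear_coefficient_zero[of _ "l * (w \<bullet> w) - w \<bullet> (A *v w)"])
    fix t :: real
    have vw: "v + t *\<^sub>R w \<in> S" using v w S(1) by (simp add: subspace_add subspace_scale)
    have "v \<bullet> (A *v w) = w \<bullet> (A *v v)"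
      using symmetric_inner[OF sym, of v w] by (simp add: inner_commute)
    then show "0 \<le> 2 * t * (l * (v \<bullet> w) - w \<bullet> (A *v v)) + t\<^sup>2 * (l * (w \<bullet> w) - w \<bullet> (A *v w))"
      using le[OF vw] nv
      by (simp add: l_def matrix_vector_mult_scaleR matrix_vector_right_distrib inner_add_left
          inner_add_right inner_commute[of w v] algebra_simps power2_eq_square)
  qed
  from this[of "l *\<^sub>R v - A *v v"] v inv S(1)
  have "(l *\<^sub>R v - A *v v) \<bullet> (l *\<^sub>R v - A *v v) = 0"
    by (simp add: inner_diff_left inner_diff_right subspace_diff subspace_scale inner_commute algebra_simps)
  then have "A *v v = l *\<^sub>R v" by simp
  with v show thesis by (intro that[of v l]) auto
qed

text \<open>Take an orthonormal set of eigenvectors of maximal cardinality. By symmetry its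
  orthogonal complement is invariant, so a nontrivial complement would contain a further
  eigenvector. Indexing by the coordinate type turns sums over eigenvectors into sums over
  \<open>UNIV\<close>.\<close>

theorem symmetric_eigenbasis:
  fixes A :: "real ^ 'n ^ 'n"
  assumes sym: "transpose A = A"
  obtains v :: "'n \<Rightarrow> real ^ 'n" and l where "orthonormal v" "\<And>i. A *v v i = l i *\<^sub>R v i"
proof -
  define P where "P B \<longleftrightarrow> pairwise orthogonal B \<and> (\<forall>b\<in>B. norm b = 1 \<and> (\<exists>l. A *v b = l *\<^sub>R b))"
    for B :: "(real ^ 'n) set"
  have ind: "independent B" if "P B" for B
    using that unfolding P_def by (intro pairwise_orthogonal_independent) auto
  have bound: "card B \<le> CARD('n)" "finite B" if "P B" for B
    using independent_bound[OF ind[OF that]] by auto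
  have "P {}" by (simp add: P_def)
  then obtain B where B: "P B" and Bmax: "\<And>B'. P B' \<Longrightarrow> card B' \<le> card B"
    using ex_has_greatest_nat[of P "{}" card "Suc CARD('n)"] bound by (metis le_imp_less_Suc)
  have "span B = UNIV"
  proof (rule ccontr)
    assume nonspan: "span B \<noteq> UNIV"
    define S where "S = {x. \<forall>b\<in>B. orthogonal b x}"
    have sub: "subspace S" unfolding S_def
      by (auto simp: subspace_def orthogonal_def inner_add_right)
    obtain z where "z \<noteq> 0" "\<And>y. y \<in> span B \<Longrightarrow> orthogonal z y"
      using orthogonal_to_subspace_exists_gen[of B UNIV] nonspan by (auto simp: psubset_eq)
    then have "z \<in> S" "z \<noteq> 0" unfolding S_def by (auto simp: span_base orthogonal_commute)
    then have "S \<noteq> {0}" by blast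
    moreover have "A *v x \<in> S" if "x \<in> S" for x
    proof -
      have "b \<bullet> (A *v x) = 0" if b: "b \<in> B" for b
      proof -
        obtain l where "A *v b = l *\<^sub>R b" using B b unfolding P_def by blast
        then show ?thesis using b \<open>x \<in> S\<close>
          by (simp add: symmetric_inner[OF sym] S_def orthogonal_def)
      qed
      then show ?thesis by (simp add: S_def orthogonal_def)
    qed
    ultimately obtain w l where w: "w \<in> S" "norm w = 1" "A *v w = l *\<^sub>R w"
      using symmetric_invariant_subspace_eigenvector[OF sym sub] by metis
    have notin: "w \<notin> B"
      using w unfolding S_def orthogonal_def by (auto simp: norm_eq_1)
    have "P (insert w B)"
      using B w unfolding P_def S_def by (auto simp: pairwise_insert orthogonal_commute)
    from Bmax[OF this] notin bound(2)[OF B] show False by simp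
  qed
  then have "card B = dim (UNIV :: (real ^ 'n) set)"
    using dim_span_eq_card_independent[OF ind[OF B]] by metis
  then have cardB: "card B = CARD('n)" by (simp only: dim_UNIV DIM_cart DIM_real mult_1_right)
  then obtain f where f: "bij_betw f (UNIV :: 'n set) B"
    using finite_same_card_bij[of "UNIV :: 'n set" B] bound(2)[OF B] cardB by auto
  have fB: "f i \<in> B" for i using f by (auto simp: bij_betw_def)
  have "\<exists>l. \<forall>i. A *v f i = l i *\<^sub>R f i"
    using B fB unfolding P_def by (intro choice) auto
  then obtain l where l: "\<And>i. A *v f i = l i *\<^sub>R f i" by blast
  have "f i \<bullet> f j = 0" if "i \<noteq> j" for i j
    using that B fB[of i] fB[of j] f unfolding P_def pairwise_def orthogonal_def bij_betw_def inj_on_def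
    by (metis UNIV_I)
  moreover have "f i \<bullet> f i = 1" for i using B fB[of i] unfolding P_def by (simp add: norm_eq_1)
  ultimately have "orthonormal f" by (auto simp: orthonormal_def)
  with l show thesis by (intro that) auto
qed

text \<open>The index type has as many elements as the dimension, so the matrix with rows
  \<open>v i\<close> is square and its right inverse is also a left inverse.\<close>

lemma orthonormal_expand:
  fixes v :: "'n \<Rightarrow> real ^ 'n"
  assumes "orthonormal v"
  shows "x = (\<Sum>i\<in>UNIV. (v i \<bullet> x) *\<^sub>R v i)"
proof -
  define Q :: "real ^ 'n ^ 'n" where "Q = (\<chi> i. v i)"
  have "Q ** transpose Q = mat 1"
    using assms by (simp add: Q_def matrix_matrix_mult_def transpose_def mat_def vec_eq_iff
        orthonormal_def inner_vec_def)
  then have "transpose Q ** Q = mat 1" by (simp add: matrix_left_right_inverse)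
  then have "x = transpose Q *v (Q *v x)" by (simp add: matrix_vector_mul_assoc)
  also have "\<dots> = (\<Sum>i\<in>UNIV. (v i \<bullet> x) *\<^sub>R v i)"
    by (simp add: vec_eq_iff matrix_vector_mult_def transpose_def Q_def inner_vec_def mult.commute)
  finally show ?thesis .
qed

lemma orthonormal_nonzero_coordinate:
  fixes v :: "'n \<Rightarrow> real ^ 'n"
  assumes "orthonormal v" "x \<noteq> 0"
  obtains i where "v i \<bullet> x \<noteq> 0"
proof -
  have "(\<Sum>i\<in>UNIV. (v i \<bullet> x) *\<^sub>R v i) = 0" if "\<And>i. v i \<bullet> x = 0" using that by simp
  then show thesis using that orthonormal_expand[OF assms(1), of x] assms(2) by metis
qed

lemma orthonormal_parseval:
  fixes v :: "'n \<Rightarrow> real ^ 'n"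
  assumes "orthonormal v"
  shows "x \<bullet> y = (\<Sum>i\<in>UNIV. (v i \<bullet> x) * (v i \<bullet> y))"
  by (subst orthonormal_expand[OF assms, of x]) (simp add: inner_sum_left)

lemma trace_orthonormal:
  fixes v :: "'n \<Rightarrow> real ^ 'n"
  assumes "orthonormal v"
  shows "trace R = (\<Sum>i\<in>UNIV. v i \<bullet> (R *v v i))"
proof -
  have "trace R = (\<Sum>k\<in>UNIV. axis k 1 \<bullet> (R *v axis k 1))"
    by (simp add: trace_def inner_axis' matrix_vector_mult_basis column_def)
  also have "\<dots> = (\<Sum>k\<in>UNIV. \<Sum>i\<in>UNIV. (v i \<bullet> axis k 1) * ((v i v* R) \<bullet> axis k 1))"
    by (subst orthonormal_parseval[OF assms]) (simp add: dot_lmul_matrix)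
  also have "\<dots> = (\<Sum>i\<in>UNIV. \<Sum>k\<in>UNIV. (v i $ k) * ((v i v* R) $ k))"
    by (subst sum.swap) (simp add: inner_axis)
  also have "\<dots> = (\<Sum>i\<in>UNIV. (v i v* R) \<bullet> v i)"
    by (simp add: inner_vec_def mult.commute)
  finally show ?thesis by (simp add: dot_lmul_matrix)
qed

section \<open>Algebra of rank-one squares, transposes and traces\<close>

lemma outer_square_mult: "outer_square x *v y = (x \<bullet> y) *\<^sub>R x"
  by (simp add: outer_square_def matrix_vector_mult_def vec_eq_iff inner_vec_def sum_distrib_left
      mult_ac)

lemma transpose_outer_square: "transpose (outer_square x) = outer_square x"
  by (simp add: outer_square_def transpose_def vec_eq_iff mult.commute)

lemma trace_outer_square: "trace (outer_square x) = x \<bullet> x"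
  by (simp add: outer_square_def trace_def inner_vec_def)

lemma transpose_add: "transpose (A + B) = transpose A + transpose B"
  by (simp add: transpose_def vec_eq_iff)

lemma transpose_diff: "transpose (A - B) = transpose A - transpose B"
  by (simp add: transpose_def vec_eq_iff)

lemma transpose_uminus: "transpose (- A :: real ^ 'n ^ 'm) = - transpose A"
  by (simp add: transpose_def vec_eq_iff)

lemma transpose_sum: "transpose (\<Sum>i\<in>I. f i) = (\<Sum>i\<in>I. transpose (f i))"
  by (simp add: transpose_def vec_eq_iff)

lemma transpose_scaleR: "transpose (c *\<^sub>R A) = c *\<^sub>R transpose A"
  by (simp add: transpose_def vec_eq_iff)

lemma matrix_vector_mult_sum_left:
  fixes f :: "'i \<Rightarrow> real ^ 'n ^ 'm"
  shows "(\<Sum>i\<in>I. f i) *v y = (\<Sum>i\<in>I. f i *v y)"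
  by (induction I rule: infinite_finite_induct) (auto simp: matrix_vector_mult_add_rdistrib)

lemma matrix_vector_mult_scaleR_left:
  fixes A :: "real ^ 'n ^ 'm"
  shows "(c *\<^sub>R A) *v y = c *\<^sub>R (A *v y)"
  by (simp add: matrix_vector_mult_def vec_eq_iff sum_distrib_left mult.assoc)

lemma matrix_vector_mult_uminus_left:
  fixes A :: "real ^ 'n ^ 'm"
  shows "(- A) *v y = - (A *v y)"
  by (simp add: matrix_vector_mult_def vec_eq_iff sum_negf)

lemma mat_vector_mult: "mat c *v y = c *\<^sub>R (y :: real ^ 'n)"
  by (simp add: matrix_vector_mult_def mat_def vec_eq_iff if_distrib[of "\<lambda>a. a * _"] cong: if_cong)

lemma trace_sum: "trace (\<Sum>i\<in>I. f i) = (\<Sum>i\<in>I. trace (f i))"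
  by (simp add: trace_def) (rule sum.swap)

lemma trace_scaleR: "trace (c *\<^sub>R A) = c * trace (A :: real ^ 'n ^ 'n)"
  by (simp add: trace_def sum_distrib_left)

subsection \<open>Rank-one updates of the barrier\<close>

text \<open>Meant for \<open>M = mat u - A\<close>: the point \<open>u\<close> lies to the right of
  the spectrum of \<open>A\<close>, and the resolvent trace there is at most \<phi>. The inverse
  appears as a right inverse, which for square matrices is unique and two-sided.\<close>

definition barrier :: "real \<Rightarrow> real ^ 'n ^ 'n \<Rightarrow> bool" where
  "barrier \<phi> M \<longleftrightarrow> transpose M = M \<and> (\<forall>x. x \<noteq> 0 \<longrightarrow> 0 < x \<bullet> (M *v x)) \<and>
    (\<exists>R. M ** R = mat 1 \<and> trace R \<le> \<phi>)"

text \<open>Test the form of \<open>M\<close> on \<open>w - z\<close> with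
  \<open>w = R' *v v\<close> and \<open>z = R *v v\<close>. Nonnegativity bounds twice the inner
  product of \<open>v\<close> and \<open>w\<close> by the form at \<open>w\<close> plus that of
  \<open>v\<close> and \<open>z\<close>; passing from \<open>M\<close> to \<open>M'\<close> bounds
  the form at \<open>w\<close> by a single inner product of \<open>v\<close> and
  \<open>w\<close>.\<close>

lemma inverse_form_antimono:
  fixes M M' R R' :: "real ^ 'n ^ 'n"
  assumes sym: "transpose M = M" "transpose M' = M'"
    and pos: "\<And>x. 0 \<le> x \<bullet> (M *v x)" and le: "\<And>x. x \<bullet> (M *v x) \<le> x \<bullet> (M' *v x)"
    and R: "M ** R = mat 1" and R': "M' ** R' = mat 1"
  shows "v \<bullet> (R' *v v) \<le> v \<bullet> (R *v v)"
proof -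
  have inv: "M *v (R *v v) = v" "M' *v (R' *v v) = v"
    using R R' by (simp_all add: matrix_vector_mul_assoc)
  define w where "w = R' *v v"
  define z where "z = R *v v"
  have "0 \<le> (w - z) \<bullet> (M *v (w - z))" by (rule pos)
  also have "\<dots> = w \<bullet> (M *v w) - 2 * (v \<bullet> w) + v \<bullet> z"
    using inv symmetric_inner[OF sym(1), of z w]
    by (simp add: z_def[symmetric] w_def[symmetric] matrix_vector_mult_diff_distrib
        inner_diff_left inner_diff_right inner_commute)
  also have "w \<bullet> (M *v w) \<le> w \<bullet> v" using le[of w] inv by (simp add: w_def)
  finally show ?thesis by (simp add: w_def z_def inner_commute)
qed

lemma posdef_right_inverse:
  fixes M :: "real ^ 'n ^ 'n"
  assumes "\<And>x. x \<noteq> 0 \<Longrightarrow> 0 < x \<bullet> (M *v x)"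
  obtains R where "M ** R = mat 1"
proof -
  have "inj ((*v) M)"
  proof (rule injI)
    fix x y assume "M *v x = M *v y"
    then have "(x - y) \<bullet> (M *v (x - y)) = 0" by (simp add: matrix_vector_mult_diff_distrib)
    then show "x = y" using assms[of "x - y"] by fastforce
  qed
  then show thesis
    using that matrix_left_invertible_injective[of M] matrix_left_right_inverse by blast
qed

text \<open>A trace is a sum of diagonal forms, so the antitonicity of inversion carries over to the
  trace bound.\<close>

lemma barrier_mono:
  fixes M M' :: "real ^ 'n ^ 'n"
  assumes "barrier \<phi> M" "transpose M' = M'" "\<And>x. x \<bullet> (M *v x) \<le> x \<bullet> (M' *v x)"
  shows "barrier \<phi> M'"
proof -
  have sym: "transpose M = M" and pos: "\<And>x. x \<noteq> 0 \<Longrightarrow> 0 < x \<bullet> (M *v x)"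
    using assms(1) by (auto simp: barrier_def)
  obtain R where R: "M ** R = mat 1" "trace R \<le> \<phi>" using assms(1) by (auto simp: barrier_def)
  have pos': "0 < x \<bullet> (M' *v x)" if "x \<noteq> 0" for x using pos[OF that] assms(3)[of x] by linarith
  obtain R' where R': "M' ** R' = mat 1" using posdef_right_inverse pos' by blast
  have onb: "orthonormal (\<lambda>i :: 'n. axis i 1 :: real ^ 'n)"
    by (auto simp: orthonormal_def inner_axis_axis)
  have "0 \<le> x \<bullet> (M *v x)" for x using pos[of x] by (cases "x = 0") auto
  then have "trace R' \<le> trace R"
    unfolding trace_orthonormal[OF onb]
    by (intro sum_mono inverse_form_antimono[OF sym assms(2) _ assms(3) R(1) R'])
  with R R' pos' assms(2) show ?thesis by (force simp: barrier_def)
qed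

lemma barrier_eigenbasis:
  fixes M :: "real ^ 'n ^ 'n"
  assumes "barrier \<phi> M"
  obtains v \<mu> where "orthonormal v" "\<And>i. M *v v i = \<mu> i *\<^sub>R v i" "\<And>i. 0 < \<mu> i"
    "(\<Sum>i\<in>UNIV. 1 / \<mu> i) \<le> \<phi>"
proof -
  have sym: "transpose M = M" and pos: "\<And>x. x \<noteq> 0 \<Longrightarrow> 0 < x \<bullet> (M *v x)"
    using assms by (auto simp: barrier_def)
  obtain R where R: "M ** R = mat 1" "trace R \<le> \<phi>" using assms by (auto simp: barrier_def)
  obtain v \<mu> where v: "orthonormal v" and \<mu>: "\<And>i. M *v v i = \<mu> i *\<^sub>R v i"
    using symmetric_eigenbasis[OF sym] by metis
  have vi: "v i \<bullet> v i = 1" for i using v by (simp add: orthonormal_def)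
  then have "v i \<noteq> 0" for i by (metis inner_zero_left zero_neq_one)
  from pos[OF this] have \<mu>pos: "0 < \<mu> i" for i by (simp add: \<mu> vi)
  have "R *v v i = (1 / \<mu> i) *\<^sub>R v i" for i
  proof -
    have "R ** M = mat 1" using R(1) matrix_left_right_inverse by blast
    then have "v i = R *v (M *v v i)" by (simp add: matrix_vector_mul_assoc)
    also have "\<dots> = \<mu> i *\<^sub>R (R *v v i)" by (simp add: \<mu> matrix_vector_mult_scaleR)
    finally have "(1 / \<mu> i) *\<^sub>R v i = (1 / \<mu> i) *\<^sub>R (\<mu> i *\<^sub>R (R *v v i))" by simp
    then show ?thesis using \<mu>pos[of i] by simp
  qed
  then have "trace R = (\<Sum>i\<in>UNIV. 1 / \<mu> i)" unfolding trace_orthonormal[OF v] by (simp add: vi)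
  with R(2) show thesis by (intro that[OF v \<mu> \<mu>pos]) auto
qed

lemma quadratic_form_eigenbasis:
  fixes v :: "'n \<Rightarrow> real ^ 'n"
  assumes "orthonormal v" "\<And>i. M *v v i = \<mu> i *\<^sub>R v i"
  shows "M *v y = (\<Sum>i\<in>UNIV. (\<mu> i * (v i \<bullet> y)) *\<^sub>R v i)"
    and "y \<bullet> (M *v y) = (\<Sum>i\<in>UNIV. \<mu> i * (v i \<bullet> y)\<^sup>2)"
proof -
  show eq: "M *v y = (\<Sum>i\<in>UNIV. (\<mu> i * (v i \<bullet> y)) *\<^sub>R v i)"
    by (subst orthonormal_expand[OF assms(1), of y])
      (simp add: linear_sum[OF matrix_vector_mul_linear] matrix_vector_mult_scaleR assms(2)
        mult.commute)
  show "y \<bullet> (M *v y) = (\<Sum>i\<in>UNIV. \<mu> i * (v i \<bullet> y)\<^sup>2)"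
    by (simp add: eq inner_sum_right inner_commute power2_eq_square mult.assoc)
qed

text \<open>One Sherman--Morrison computation serves both signs, and \<open>d\<close> may be
  negative. With \<open>w\<close> the inverse of \<open>M + mat d\<close> applied to
  \<open>x\<close>, the shift lowers the trace of the inverse by \<open>d\<close> times the sum of
  \<open>1 / (\<mu> i * (\<mu> i + d))\<close>, and the rank-one term raises it by
  \<open>\<sigma> / (1 - \<sigma> * q)\<close> times the squared norm of \<open>w\<close>, both read
  with signs. The hypothesis \<open>shift\<close> says that the total change is not
  positive.\<close>

lemma barrier_rank_one_update:
  fixes v :: "'n \<Rightarrow> real ^ 'n"
  assumes sym: "transpose M = M" and v: "orthonormal v" and M: "\<And>i. M *v v i = \<mu> i *\<^sub>R v i"
    and \<mu>: "\<And>i. 0 < \<mu> i" "\<And>i. 0 < \<mu> i + d" and \<phi>: "(\<Sum>i\<in>UNIV. 1 / \<mu> i) \<le> \<phi>"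
    and \<sigma>: "\<sigma> = 1 \<or> \<sigma> = - 1"
    and q: "q = (\<Sum>i\<in>UNIV. (v i \<bullet> x)\<^sup>2 / (\<mu> i + d))" "\<sigma> * q < 1"
    and shift: "\<sigma> * (\<Sum>i\<in>UNIV. (v i \<bullet> x)\<^sup>2 / (\<mu> i + d)\<^sup>2)
      \<le> (1 - \<sigma> * q) * (d * (\<Sum>i\<in>UNIV. 1 / (\<mu> i * (\<mu> i + d))))"
  shows "barrier \<phi> (M + mat d - \<sigma> *\<^sub>R outer_square x)"
proof -
  let ?m = "\<lambda>i. \<mu> i + d"
  let ?M = "M + mat d - \<sigma> *\<^sub>R outer_square x"
  define w where "w = (\<Sum>i\<in>UNIV. ((v i \<bullet> x) / ?m i) *\<^sub>R v i)"
  define k where "k = \<sigma> / (1 - \<sigma> * q)"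
  \<comment> \<open>The Sherman--Morrison inverse; its first sum is the inverse of
    \<open>M + mat d\<close> in the eigenbasis.\<close>
  define R where "R = (\<Sum>i\<in>UNIV. (1 / ?m i) *\<^sub>R outer_square (v i)) + k *\<^sub>R outer_square w"
  have mne: "?m i \<noteq> 0" for i using \<mu>(2)[of i] by linarith
  have Md: "(M + mat d) *v v i = ?m i *\<^sub>R v i" for i
    by (simp add: matrix_vector_mult_add_rdistrib M mat_vector_mult scaleR_left_distrib)
  have Mmult: "?M *v y = (M + mat d) *v y - (\<sigma> * (x \<bullet> y)) *\<^sub>R x" for y
    by (simp add: matrix_vector_mult_diff_rdistrib matrix_vector_mult_scaleR_left outer_square_mult)
  have vw: "v i \<bullet> w = (v i \<bullet> x) / ?m i" for i
    using v by (simp add: w_def inner_sum_right orthonormal_def if_distrib[of "\<lambda>a. _ * a"] cong: if_cong)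
  have Mw: "(M + mat d) *v w = x"
    using mne by (simp add: quadratic_form_eigenbasis(1)[OF v Md] vw orthonormal_expand[OF v, symmetric])
  have xw: "x \<bullet> w = q"
    by (simp add: w_def inner_sum_right q(1) power2_eq_square inner_commute)
  have ww: "w \<bullet> w = (\<Sum>i\<in>UNIV. (v i \<bullet> x)\<^sup>2 / (?m i)\<^sup>2)"
    by (subst orthonormal_parseval[OF v]) (simp add: vw power2_eq_square)
  have "?M ** R = mat 1"
  proof (subst matrix_eq, intro allI)
    fix y :: "real ^ 'n"
    define r where "r = (\<Sum>i\<in>UNIV. ((v i \<bullet> y) / ?m i) *\<^sub>R v i)"
    have vr: "v i \<bullet> r = (v i \<bullet> y) / ?m i" for i
      using v by (simp add: r_def inner_sum_right orthonormal_def if_distrib[of "\<lambda>a. _ * a"] cong: if_cong)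
    have Mr: "(M + mat d) *v r = y"
      using mne by (simp add: quadratic_form_eigenbasis(1)[OF v Md] vr orthonormal_expand[OF v, symmetric])
    have xr: "x \<bullet> r = w \<bullet> y"
      by (simp add: r_def w_def inner_sum_right inner_sum_left inner_commute mult.commute)
    have Ry: "R *v y = r + (k * (w \<bullet> y)) *\<^sub>R w"
      by (simp add: R_def r_def matrix_vector_mult_add_rdistrib matrix_vector_mult_sum_left
          matrix_vector_mult_scaleR_left outer_square_mult)
    have "?M *v (R *v y) = (M + mat d) *v (r + (k * (w \<bullet> y)) *\<^sub>R w)
        - (\<sigma> * (x \<bullet> (r + (k * (w \<bullet> y)) *\<^sub>R w))) *\<^sub>R x"
      by (simp only: Mmult Ry)
    also have "\<dots> = y + (k * (w \<bullet> y)) *\<^sub>R x - (\<sigma> * (w \<bullet> y + k * (w \<bullet> y) * q)) *\<^sub>R x"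
      by (simp only: matrix_vector_right_distrib matrix_vector_mult_scaleR Mr Mw
          inner_add_right inner_scaleR_right xr xw)
    also have "\<dots> = y + (k * (w \<bullet> y) - \<sigma> * (w \<bullet> y + k * (w \<bullet> y) * q)) *\<^sub>R x"
      by (simp add: scaleR_left_diff_distrib)
    also have "k * (w \<bullet> y) - \<sigma> * (w \<bullet> y + k * (w \<bullet> y) * q) = (w \<bullet> y) * (k * (1 - \<sigma> * q) - \<sigma>)"
      by (simp add: algebra_simps)
    also have "k * (1 - \<sigma> * q) = \<sigma>" using q(2) by (simp add: k_def)
    finally show "(?M ** R) *v y = mat 1 *v y" by (simp add: matrix_vector_mul_assoc)
  qed
  moreover have "trace R \<le> \<phi>"
  proof -
    have "trace R = (\<Sum>i\<in>UNIV. 1 / ?m i) + k * (w \<bullet> w)"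
      using v by (simp add: R_def trace_add trace_sum trace_scaleR trace_outer_square orthonormal_def)
    moreover have "(\<Sum>i\<in>UNIV. 1 / ?m i)
        = (\<Sum>i\<in>UNIV. 1 / \<mu> i) - d * (\<Sum>i\<in>UNIV. 1 / (\<mu> i * ?m i))"
    proof -
      have "1 / ?m i = 1 / \<mu> i - d * (1 / (\<mu> i * ?m i))" for i
      proof -
        have "1 / \<mu> i - 1 / ?m i = (1 * ?m i - 1 * \<mu> i) / (\<mu> i * ?m i)"
          using \<mu>(1)[of i] mne[of i] by (intro diff_frac_eq) auto
        then show ?thesis by simp
      qed
      then show ?thesis by (simp add: sum_subtractf sum_distrib_left)
    qed
    moreover have "k * (w \<bullet> w) \<le> d * (\<Sum>i\<in>UNIV. 1 / (\<mu> i * ?m i))"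
      using shift q(2) by (simp add: k_def ww pos_divide_le_eq mult.commute)
    ultimately show ?thesis using \<phi> by linarith
  qed
  moreover have "0 < y \<bullet> (?M *v y)" if y: "y \<noteq> 0" for y
  proof -
    define S where "S = (\<Sum>i\<in>UNIV. ?m i * (v i \<bullet> y)\<^sup>2)"
    have S0: "0 < S"
    proof -
      obtain i where i: "v i \<bullet> y \<noteq> 0" using orthonormal_nonzero_coordinate[OF v y] by blast
      show ?thesis unfolding S_def
        using i \<mu>(2) by (intro sum_pos2[of _ i]) (auto simp: less_imp_le)
    qed
    \<comment> \<open>Splitting off \<open>sqrt (?m i)\<close> before Cauchy--Schwarz brings in the
      form \<open>S\<close> of the shifted matrix; for \<sigma> equal to 1, \<open>q < 1\<close>
      then leaves the updated form positive.\<close>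
    have "(x \<bullet> y)\<^sup>2 = (\<Sum>i\<in>UNIV. ((v i \<bullet> x) / sqrt (?m i)) * (sqrt (?m i) * (v i \<bullet> y)))\<^sup>2"
      using mne by (simp add: orthonormal_parseval[OF v, of x y] mult.commute)
    also have "\<dots> \<le> (\<Sum>i\<in>UNIV. ((v i \<bullet> x) / sqrt (?m i))\<^sup>2) * (\<Sum>i\<in>UNIV. (sqrt (?m i) * (v i \<bullet> y))\<^sup>2)"
      by (rule Cauchy_Schwarz_ineq_sum)
    also have "\<dots> = q * S"
      using \<mu>(2) by (simp add: q(1) S_def power_mult_distrib power_divide less_imp_le)
    finally have cs: "(x \<bullet> y)\<^sup>2 \<le> q * S" .
    have "y \<bullet> (?M *v y) = S - \<sigma> * (x \<bullet> y)\<^sup>2"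
      by (simp add: Mmult inner_diff_right quadratic_form_eigenbasis(2)[OF v Md] S_def inner_commute
          power2_eq_square mult.assoc)
    also have "\<dots> > 0"
    proof (cases "\<sigma> = 1")
      case True
      have "q * S < 1 * S" using q(2) S0 True by (intro mult_strict_right_mono) auto
      then show ?thesis using cs True by simp
    next
      case False
      then show ?thesis using \<sigma> S0 by (simp add: add_pos_nonneg)
    qed
    finally show ?thesis .
  qed
  moreover have "transpose ?M = ?M"
    by (simp add: transpose_diff transpose_add sym transpose_scaleR transpose_outer_square)
  ultimately show ?thesis unfolding barrier_def by blast
qed

text \<open>Each \<open>1 / \<mu> i\<close> is at most the reciprocal of the minimum, and the
  denominator contains the square of that reciprocal. The left side is the average that serves as
  the typical shift; the bound makes it small relative to every eigenvalue once the resolvent form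
  is small.\<close>

lemma inverse_square_average_le:
  fixes \<mu> a :: "'n::finite \<Rightarrow> real"
  assumes \<mu>: "\<And>i. 0 < \<mu> i" and a: "\<And>i. 0 \<le> a i"
  shows "(\<Sum>i\<in>UNIV. a i / (\<mu> i)\<^sup>2) / (\<Sum>i\<in>UNIV. 1 / (\<mu> i)\<^sup>2)
    \<le> Min (range \<mu>) * (\<Sum>i\<in>UNIV. a i / \<mu> i)"
proof -
  define m where "m = Min (range \<mu>)"
  have m_le: "m \<le> \<mu> i" for i by (simp add: m_def)
  have "m \<in> range \<mu>" unfolding m_def by (intro Min_in) auto
  then obtain k where k: "m = \<mu> k" by blast
  have m0: "0 < m" using \<mu> k by simp
  have T: "1 / m\<^sup>2 \<le> (\<Sum>i\<in>UNIV. 1 / (\<mu> i)\<^sup>2)"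
    unfolding k by (rule member_le_sum) auto
  then have T0: "0 < (\<Sum>i\<in>UNIV. 1 / (\<mu> i)\<^sup>2)" using m0 by (smt (verit) zero_less_divide_1_iff zero_less_power)
  have "(\<Sum>i\<in>UNIV. a i / (\<mu> i)\<^sup>2) \<le> (\<Sum>i\<in>UNIV. (a i / \<mu> i) * (1 / m))"
  proof (rule sum_mono)
    fix i
    have "1 / \<mu> i \<le> 1 / m" using m_le m0 by (simp add: frac_le)
    then have "(a i / \<mu> i) * (1 / \<mu> i) \<le> (a i / \<mu> i) * (1 / m)"
      using \<mu>[of i] a[of i] by (intro mult_left_mono) auto
    then show "a i / (\<mu> i)\<^sup>2 \<le> (a i / \<mu> i) * (1 / m)" by (simp add: power2_eq_square)
  qed
  also have "\<dots> = (\<Sum>i\<in>UNIV. a i / \<mu> i) * (1 / m)" by (simp only: sum_distrib_right)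
  also have "\<dots> = (m * (\<Sum>i\<in>UNIV. a i / \<mu> i)) * (1 / m\<^sup>2)"
    using m0 by (simp add: power2_eq_square)
  also have "\<dots> \<le> (m * (\<Sum>i\<in>UNIV. a i / \<mu> i)) * (\<Sum>i\<in>UNIV. 1 / (\<mu> i)\<^sup>2)"
    using T m0 \<mu> a by (intro mult_left_mono mult_nonneg_nonneg sum_nonneg divide_nonneg_pos) auto
  finally show ?thesis using T0 by (simp add: m_def[symmetric] pos_divide_le_eq)
qed

text \<open>To first order the shift is \<open>q2\<close>. Since
  \<open>q2 \<le> \<mu> i * s\<close>, the shift multiplies each eigenvalue by at most
  \<open>(1 - s) / (1 - 2 * s)\<close>; together with \<open>1 - q \<ge> 1 - s\<close> this loses
  the factor \<open>1 - 2 * s\<close>, for which the denominator of the shift makes up.\<close>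

lemma barrier_shift_up_small:
  fixes v :: "'n \<Rightarrow> real ^ 'n"
  assumes sym: "transpose M = M" and v: "orthonormal v" and M: "\<And>i. M *v v i = \<mu> i *\<^sub>R v i"
    and \<mu>: "\<And>i. 0 < \<mu> i" and \<phi>: "(\<Sum>i\<in>UNIV. 1 / \<mu> i) \<le> \<phi>"
    and s: "(\<Sum>i\<in>UNIV. (v i \<bullet> x)\<^sup>2 / \<mu> i) \<le> s" "s < 1 / 2"
    and q2: "q2 = (\<Sum>i\<in>UNIV. (v i \<bullet> x)\<^sup>2 / (\<mu> i)\<^sup>2) / (\<Sum>i\<in>UNIV. 1 / (\<mu> i)\<^sup>2)"
  shows "barrier \<phi> (M + mat (q2 / (1 - 2 * s)) - outer_square x)"
proof -
  let ?a = "\<lambda>i. (v i \<bullet> x)\<^sup>2"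
  define T where "T = (\<Sum>i\<in>UNIV. 1 / (\<mu> i)\<^sup>2)"
  define d where "d = q2 / (1 - 2 * s)"
  have "\<mu> i \<noteq> 0" for i using \<mu>[of i] by linarith
  then have T0: "0 < T" unfolding T_def by (intro sum_pos) auto
  have q2T: "q2 * T = (\<Sum>i\<in>UNIV. ?a i / (\<mu> i)\<^sup>2)" using T0 by (simp add: q2 T_def)
  have q20: "0 \<le> q2" unfolding q2 by (intro divide_nonneg_nonneg sum_nonneg) auto
  have "0 \<le> (\<Sum>i\<in>UNIV. ?a i / \<mu> i)" using \<mu> by (intro sum_nonneg divide_nonneg_pos) auto
  then have s0: "0 \<le> s" using s(1) by linarith
  have q2_le: "q2 \<le> \<mu> i * s" for i
  proof -
    have "q2 \<le> Min (range \<mu>) * (\<Sum>i\<in>UNIV. ?a i / \<mu> i)"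
      unfolding q2 using \<mu> by (intro inverse_square_average_le) auto
    also have "\<dots> \<le> \<mu> i * s"
      using s(1) \<mu> less_imp_le[OF \<mu>[of i]] by (intro mult_mono sum_nonneg divide_nonneg_pos) auto
    finally show ?thesis .
  qed
  have d0: "0 \<le> d" using q20 s by (simp add: d_def)
  have d\<mu>: "\<mu> i + d \<le> \<mu> i * ((1 - s) / (1 - 2 * s))" for i
  proof -
    have "d \<le> \<mu> i * s / (1 - 2 * s)" unfolding d_def using q2_le s(2) by (intro divide_right_mono) auto
    moreover have "(1 - s) / (1 - 2 * s) = 1 + s / (1 - 2 * s)"
      using s(2) by (simp add: eq_divide_eq divide_eq_eq distrib_right)
    ultimately show ?thesis by (simp add: distrib_left)
  qed
  have pos: "0 < \<mu> i + d" for i using \<mu>[of i] d0 by simp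
  define q where "q = (\<Sum>i\<in>UNIV. ?a i / (\<mu> i + d))"
  have "q \<le> (\<Sum>i\<in>UNIV. ?a i / \<mu> i)"
    unfolding q_def using \<mu> d0 by (intro sum_mono divide_left_mono mult_pos_pos pos) auto
  then have qs: "q \<le> s" using s(1) by simp
  have "(\<Sum>i\<in>UNIV. ?a i / (\<mu> i + d)\<^sup>2) \<le> (\<Sum>i\<in>UNIV. ?a i / (\<mu> i)\<^sup>2)"
    using less_imp_le[OF \<mu>] d0 \<mu> pos
    by (intro sum_mono divide_left_mono mult_pos_pos power_mono zero_less_power) auto
  also have "\<dots> = (1 - s) * (d * (T * ((1 - 2 * s) / (1 - s))))"
    using s(2) by (simp add: q2T[symmetric] d_def)
  also have "\<dots> \<le> (1 - q) * (d * (\<Sum>i\<in>UNIV. 1 / (\<mu> i * (\<mu> i + d))))"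
  proof (intro mult_mono mult_nonneg_nonneg sum_nonneg)
    have "1 / (\<mu> i)\<^sup>2 * ((1 - 2 * s) / (1 - s)) \<le> 1 / (\<mu> i * (\<mu> i + d))" for i
    proof -
      have "1 / (\<mu> i * (\<mu> i * ((1 - s) / (1 - 2 * s)))) \<le> 1 / (\<mu> i * (\<mu> i + d))"
        using \<mu>[of i] pos[of i] d\<mu>[of i] s(2)
        by (intro divide_left_mono mult_left_mono mult_pos_pos divide_pos_pos) auto
      then show ?thesis using s(2) by (simp add: power2_eq_square mult.assoc)
    qed
    then show "T * ((1 - 2 * s) / (1 - s)) \<le> (\<Sum>i\<in>UNIV. 1 / (\<mu> i * (\<mu> i + d)))"
      unfolding T_def sum_distrib_right by (intro sum_mono) auto
  qed (use qs s s0 d0 T0 less_imp_le[OF \<mu>] less_imp_le[OF pos] in auto)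
  finally have "barrier \<phi> (M + mat d - 1 *\<^sub>R outer_square x)"
    using qs s(2) by (intro barrier_rank_one_update[OF sym v M \<mu> pos \<phi> _ q_def]) auto
  then show ?thesis by (simp add: d_def)
qed

text \<open>Now the shift moves towards singularity, but \<open>q2 \<le> \<mu> i * s\<close>
  preserves at least the fraction \<open>1 - s\<close> of each eigenvalue. The factor
  \<open>1 + q\<close> and the enlarged reciprocals each cost at most \<open>1 / (1 - s)\<close>,
  and \<open>1 - 2 * s \<le> (1 - s)\<^sup>2\<close> pays for both.\<close>

lemma barrier_shift_down:
  fixes v :: "'n \<Rightarrow> real ^ 'n"
  assumes sym: "transpose M = M" and v: "orthonormal v" and M: "\<And>i. M *v v i = \<mu> i *\<^sub>R v i"
    and \<mu>: "\<And>i. 0 < \<mu> i" and \<phi>: "(\<Sum>i\<in>UNIV. 1 / \<mu> i) \<le> \<phi>"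
    and s: "(\<Sum>i\<in>UNIV. (v i \<bullet> x)\<^sup>2 / \<mu> i) \<le> s" "s < 1 / 2"
    and q2: "q2 = (\<Sum>i\<in>UNIV. (v i \<bullet> x)\<^sup>2 / (\<mu> i)\<^sup>2) / (\<Sum>i\<in>UNIV. 1 / (\<mu> i)\<^sup>2)"
  shows "barrier \<phi> (M + mat (- ((1 - 2 * s) * q2)) + outer_square x)"
proof -
  let ?a = "\<lambda>i. (v i \<bullet> x)\<^sup>2"
  define T where "T = (\<Sum>i\<in>UNIV. 1 / (\<mu> i)\<^sup>2)"
  define d where "d = (1 - 2 * s) * q2"
  have "\<mu> i \<noteq> 0" for i using \<mu>[of i] by linarith
  then have T0: "0 < T" unfolding T_def by (intro sum_pos) auto
  have q2T: "q2 * T = (\<Sum>i\<in>UNIV. ?a i / (\<mu> i)\<^sup>2)" using T0 by (simp add: q2 T_def)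
  have q20: "0 \<le> q2" unfolding q2 by (intro divide_nonneg_nonneg sum_nonneg) auto
  have "0 \<le> (\<Sum>i\<in>UNIV. ?a i / \<mu> i)" using \<mu> by (intro sum_nonneg divide_nonneg_pos) auto
  then have s0: "0 \<le> s" using s(1) by linarith
  have q2_le: "q2 \<le> \<mu> i * s" for i
  proof -
    have "q2 \<le> Min (range \<mu>) * (\<Sum>i\<in>UNIV. ?a i / \<mu> i)"
      unfolding q2 using \<mu> by (intro inverse_square_average_le) auto
    also have "\<dots> \<le> \<mu> i * s"
      using s(1) \<mu> less_imp_le[OF \<mu>[of i]] by (intro mult_mono sum_nonneg divide_nonneg_pos) auto
    finally show ?thesis .
  qed
  have d0: "0 \<le> d" using q20 s by (simp add: d_def)
  have "d \<le> 1 * q2" unfolding d_def using s0 q20 by (intro mult_right_mono) auto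
  then have d\<mu>: "\<mu> i * (1 - s) \<le> \<mu> i - d" for i
    using q2_le[of i] by (simp add: algebra_simps)
  have pos': "0 < \<mu> i * (1 - s)" for i using \<mu>[of i] s(2) by simp
  then have pos: "0 < \<mu> i - d" for i using d\<mu>[of i] by (meson less_le_trans)
  define q where "q = (\<Sum>i\<in>UNIV. ?a i / (\<mu> i - d))"
  have "q \<le> (\<Sum>i\<in>UNIV. ?a i / (\<mu> i * (1 - s)))"
    unfolding q_def using pos \<mu> s(2) d\<mu> by (intro sum_mono divide_left_mono mult_pos_pos) auto
  also have "\<dots> = (\<Sum>i\<in>UNIV. ?a i / \<mu> i) / (1 - s)" by (simp add: sum_divide_distrib)
  also have "\<dots> \<le> s / (1 - s)" using s by (intro divide_right_mono) auto
  finally have qs: "q \<le> s / (1 - s)" .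
  have q0: "0 \<le> q" unfolding q_def using pos by (intro sum_nonneg divide_nonneg_pos) auto
  have "(1 + q) * (d * (\<Sum>i\<in>UNIV. 1 / (\<mu> i * (\<mu> i - d)))) \<le> (1 + s / (1 - s)) * (d * (T * (1 / (1 - s))))"
  proof (intro mult_mono mult_nonneg_nonneg sum_nonneg)
    have "1 / (\<mu> i * (\<mu> i - d)) \<le> 1 / (\<mu> i)\<^sup>2 * (1 / (1 - s))" for i
    proof -
      have "1 / (\<mu> i * (\<mu> i - d)) \<le> 1 / (\<mu> i * (\<mu> i * (1 - s)))"
        using \<mu>[of i] pos[of i] s(2) d\<mu>[of i]
        by (intro divide_left_mono mult_left_mono mult_pos_pos) auto
      then show ?thesis by (simp add: power2_eq_square mult.assoc)
    qed
    then show "(\<Sum>i\<in>UNIV. 1 / (\<mu> i * (\<mu> i - d))) \<le> T * (1 / (1 - s))"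
      unfolding T_def sum_distrib_right by (intro sum_mono) auto
  qed (use qs s s0 d0 T0 less_imp_le[OF \<mu>] less_imp_le[OF pos] in auto)
  also have "\<dots> = (1 - 2 * s) / (1 - s)\<^sup>2 * (q2 * T)"
    using s(2) by (simp add: d_def field_simps power2_eq_square)
  also have "\<dots> \<le> 1 * (q2 * T)"
  proof (intro mult_right_mono)
    have "1 - 2 * s \<le> (1 - s)\<^sup>2" by (simp add: power2_eq_square algebra_simps)
    then show "(1 - 2 * s) / (1 - s)\<^sup>2 \<le> 1" using s(2) by simp
  qed (use q20 T0 in auto)
  also have "\<dots> \<le> (\<Sum>i\<in>UNIV. ?a i / (\<mu> i - d)\<^sup>2)"
    unfolding mult_1 q2T using \<mu> d0 pos
    by (intro sum_mono divide_left_mono mult_pos_pos power_mono zero_less_power)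
      (auto simp: less_imp_le)
  finally have "barrier \<phi> (M + mat (- d) - (- 1) *\<^sub>R outer_square x)"
    using q0 pos by (intro barrier_rank_one_update[OF sym v M \<mu> _ \<phi>, where q = q]) 
        (auto simp: q_def algebra_simps)
  then show ?thesis by (simp add: d_def)
qed

text \<open>A coarse shift for vectors with a large resolvent form. The term of the smallest
  eigenvalue \<open>m\<close> alone pays for the update, because \<open>m \<le> d\<close> gives
  \<open>1 / (m + d) \<le> d / (m * (m + d))\<close>.\<close>

lemma barrier_shift_up_large:
  fixes v :: "'n \<Rightarrow> real ^ 'n"
  assumes sym: "transpose M = M" and v: "orthonormal v" and M: "\<And>i. M *v v i = \<mu> i *\<^sub>R v i"
    and \<mu>: "\<And>i. 0 < \<mu> i" and \<phi>: "(\<Sum>i\<in>UNIV. 1 / \<mu> i) \<le> \<phi>"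
    and d: "(\<Sum>i\<in>UNIV. (v i \<bullet> x)\<^sup>2 / (\<mu> i + d)) \<le> 1 / 2" "Min (range \<mu>) \<le> d"
  shows "barrier \<phi> (M + mat d - outer_square x)"
proof -
  let ?a = "\<lambda>i. (v i \<bullet> x)\<^sup>2"
  define m where "m = Min (range \<mu>)"
  have m_le: "m \<le> \<mu> i" for i by (simp add: m_def)
  have "m \<in> range \<mu>" unfolding m_def by (intro Min_in) auto
  then obtain k where k: "m = \<mu> k" by blast
  have m0: "0 < m" using \<mu> k by simp
  have d0: "0 < d" using d(2) m0 unfolding m_def by linarith
  have pos: "0 < \<mu> i + d" for i using \<mu>[of i] d0 by simp
  define q where "q = (\<Sum>i\<in>UNIV. ?a i / (\<mu> i + d))"
  have q: "q \<le> 1 / 2" using d(1) by (simp add: q_def)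
  have "(\<Sum>i\<in>UNIV. ?a i / (\<mu> i + d)\<^sup>2) \<le> (\<Sum>i\<in>UNIV. (?a i / (\<mu> i + d)) * (1 / (m + d)))"
  proof (rule sum_mono)
    fix i
    have "(?a i / (\<mu> i + d)) * (1 / (\<mu> i + d)) \<le> (?a i / (\<mu> i + d)) * (1 / (m + d))"
      using pos[of i] m0 d0 m_le[of i] by (intro mult_left_mono divide_left_mono) auto
    then show "?a i / (\<mu> i + d)\<^sup>2 \<le> (?a i / (\<mu> i + d)) * (1 / (m + d))"
      by (simp add: power2_eq_square)
  qed
  also have "\<dots> = q * (1 / (m + d))" by (simp only: q_def sum_distrib_right)
  also have "\<dots> \<le> (1 - q) * (1 / (m + d))" using q m0 d0 by (intro mult_right_mono) auto
  also have "\<dots> \<le> (1 - q) * (d * (1 / (m * (m + d))))"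
  proof (intro mult_left_mono)
    have "1 * (1 / (m + d)) \<le> d / m * (1 / (m + d))"
      using m0 d0 d(2) by (intro mult_right_mono) (auto simp: m_def[symmetric])
    then show "1 / (m + d) \<le> d * (1 / (m * (m + d)))" by simp
  qed (use q in simp)
  also have "\<dots> \<le> (1 - q) * (d * (\<Sum>i\<in>UNIV. 1 / (\<mu> i * (\<mu> i + d))))"
  proof (intro mult_left_mono)
    have "0 \<le> 1 / (\<mu> i * (\<mu> i + d))" for i
      using less_imp_le[OF \<mu>[of i]] less_imp_le[OF pos[of i]] by simp
    then show "1 / (m * (m + d)) \<le> (\<Sum>i\<in>UNIV. 1 / (\<mu> i * (\<mu> i + d)))"
      unfolding k by (intro member_le_sum) auto
  qed (use q d0 in auto)
  finally have "barrier \<phi> (M + mat d - 1 *\<^sub>R outer_square x)"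
    using q by (intro barrier_rank_one_update[OF sym v M \<mu> pos \<phi> _ q_def]) auto
  then show ?thesis by simp
qed

subsection \<open>The soft edge of a matrix\<close>

definition symmetric_part :: "real ^ 'n ^ 'n \<Rightarrow> real ^ 'n ^ 'n" where
  "symmetric_part A = (1 / 2) *\<^sub>R (A + transpose A)"

lemma transpose_symmetric_part: "transpose (symmetric_part A) = symmetric_part A"
  by (simp add: symmetric_part_def transpose_scaleR transpose_add add.commute)

lemma symmetric_part_eq: "transpose A = A \<Longrightarrow> symmetric_part A = A"
  by (simp add: symmetric_part_def flip: scaleR_2)

lemma symmetric_part_add: "symmetric_part (A + B) = symmetric_part A + symmetric_part B"
  by (simp add: symmetric_part_def transpose_add scaleR_right_distrib)

lemma quadratic_form_symmetric_part: "x \<bullet> (symmetric_part A *v x) = x \<bullet> (A *v x)"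
proof -
  have "x \<bullet> (transpose A *v x) = (A *v x) \<bullet> x"
    by (metis dot_lmul_matrix vector_transpose_matrix)
  then have "x \<bullet> (transpose A *v x) = x \<bullet> (A *v x)" by (simp add: inner_commute)
  then show ?thesis
    by (simp add: symmetric_part_def matrix_vector_mult_scaleR_left matrix_vector_mult_add_rdistrib
        inner_add_right)
qed

lemma transpose_mat [simp]: "transpose (mat c) = mat c"
  by (simp add: transpose_def mat_def vec_eq_iff)

lemma mat_add: "mat (a + b) = (mat a + mat b :: 'a::monoid_add ^ 'n ^ 'n)"
  by (simp add: mat_def vec_eq_iff)

lemma norm_matrix_vector_mult_le:
  fixes A :: "real ^ 'n ^ 'm"
  shows "norm (A *v x) \<le> norm A * norm x"
proof -
  have "norm (A *v x) \<le> L2_set (\<lambda>i. norm (A $ i) * norm x) UNIV"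
    unfolding norm_vec_def[of "A *v x"]
    by (intro L2_set_mono) (auto simp: matrix_vector_mul_component Cauchy_Schwarz_ineq2)
  also have "\<dots> = norm A * norm x"
    by (simp add: norm_vec_def[of A] L2_set_left_distrib)
  finally show ?thesis .
qed

lemma quadratic_form_le_norm:
  fixes A :: "real ^ 'n ^ 'n"
  shows "\<bar>x \<bullet> (A *v x)\<bar> \<le> norm A * (x \<bullet> x)"
proof -
  have "\<bar>x \<bullet> (A *v x)\<bar> \<le> norm x * norm (A *v x)" by (rule Cauchy_Schwarz_ineq2)
  also have "\<dots> \<le> norm x * (norm A * norm x)"
    by (intro mult_left_mono norm_matrix_vector_mult_le) auto
  finally show ?thesis by (simp add: dot_square_norm power2_eq_square mult_ac)
qed

text \<open>Symmetrizing the argument makes the soft edge Lipschitz on the space of all matrices.\<close>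

definition soft_max :: "real \<Rightarrow> real ^ 'n ^ 'n \<Rightarrow> real" where
  "soft_max \<phi> A = Inf {u. barrier \<phi> (mat u - symmetric_part A)}"

context
  fixes \<phi> :: real
  assumes \<phi>: "0 < \<phi>"
begin

lemma barrier_mat: "barrier \<phi> (mat (real CARD('n) / \<phi>) :: real ^ 'n ^ 'n)"
proof -
  have "mat (real CARD('n) / \<phi>) ** mat (\<phi> / real CARD('n)) = (mat 1 :: real ^ 'n ^ 'n)"
    using \<phi> by (subst matrix_eq) (simp add: matrix_vector_mul_assoc[symmetric] mat_vector_mult)
  moreover have "trace (mat (\<phi> / real CARD('n)) :: real ^ 'n ^ 'n) \<le> \<phi>"
    by (simp add: trace_def mat_def)
  ultimately show ?thesis using \<phi> unfolding barrier_def
    by (auto simp: mat_vector_mult)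
qed

text \<open>The multiple of the identity whose inverse has trace \<phi> satisfies the barrier, and
  \<open>norm A\<close> compensates for subtracting \<open>A\<close>. Hence the infimum defining the
  soft edge is over a nonempty set; for \<open>A = 0\<close> this is the starting value.\<close>

lemma barrier_soft_max_ex: "barrier \<phi> (mat (real CARD('n) / \<phi> + norm A) - symmetric_part (A :: real ^ 'n ^ 'n))"
proof (rule barrier_mono[OF barrier_mat])
  fix x :: "real ^ 'n"
  show "x \<bullet> (mat (real CARD('n) / \<phi>) *v x) \<le> x \<bullet> ((mat (real CARD('n) / \<phi> + norm A) - symmetric_part A) *v x)"
    using quadratic_form_le_norm[of x A]
    by (simp add: matrix_vector_mult_diff_rdistrib mat_vector_mult inner_diff_right
        quadratic_form_symmetric_part algebra_simps)
qed (simp add: transpose_diff transpose_symmetric_part)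

lemma barrier_quadratic_form:
  assumes "barrier \<phi> (mat u - symmetric_part A)"
  shows "x \<bullet> (A *v x) \<le> u * (x \<bullet> x)"
proof (cases "x = 0")
  case False
  then have "0 < x \<bullet> ((mat u - symmetric_part A) *v x)" using assms by (simp add: barrier_def)
  then show ?thesis
    by (simp add: matrix_vector_mult_diff_rdistrib mat_vector_mult inner_diff_right
        quadratic_form_symmetric_part)
qed simp

lemma barrier_bdd_below: "bdd_below {u. barrier \<phi> (mat u - symmetric_part (A :: real ^ 'n ^ 'n))}"
proof -
  \<comment> \<open>Any coordinate vector gives a lower bound; \<open>undefined\<close> merely names
    an index.\<close>
  let ?e = "axis undefined 1 :: real ^ 'n"
  have "?e \<bullet> (A *v ?e) \<le> u" if "barrier \<phi> (mat u - symmetric_part A)" for u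
    using barrier_quadratic_form[OF that, of ?e] by (simp add: inner_axis_axis)
  then show ?thesis by (intro bdd_belowI) auto
qed

lemma soft_max_le: "barrier \<phi> (mat u - symmetric_part A) \<Longrightarrow> soft_max \<phi> A \<le> u"
  unfolding soft_max_def using barrier_bdd_below by (intro cInf_lower) auto

text \<open>Admissible points form an up-set, so all points strictly above the infimum are
  admissible. Attainment of the infimum is left open, which is why later estimates work slightly
  above it.\<close>

lemma barrier_above_soft_max:
  fixes A :: "real ^ 'n ^ 'n"
  assumes "soft_max \<phi> A < u"
  shows "barrier \<phi> (mat u - symmetric_part A)"
proof -
  obtain u' where u': "barrier \<phi> (mat u' - symmetric_part A)" "u' < u"
    using assms barrier_soft_max_ex[of A] cInf_lessD[of "{u. barrier \<phi> (mat u - symmetric_part A)}" u]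
    unfolding soft_max_def by blast
  show ?thesis
  proof (rule barrier_mono[OF u'(1)])
    fix x :: "real ^ 'n"
    show "x \<bullet> ((mat u' - symmetric_part A) *v x) \<le> x \<bullet> ((mat u - symmetric_part A) *v x)"
      using u'(2) by (simp add: matrix_vector_mult_diff_rdistrib mat_vector_mult inner_diff_right
          mult_right_mono)
  qed (simp add: transpose_diff transpose_symmetric_part)
qed

lemma quadratic_form_le_soft_max: "x \<bullet> (A *v x) \<le> soft_max \<phi> A * (x \<bullet> x)"
proof (rule field_le_epsilon)
  fix e :: real assume "0 < e"
  show "x \<bullet> (A *v x) \<le> soft_max \<phi> A * (x \<bullet> x) + e"
  proof (cases "x = 0")
    case False
    then have "soft_max \<phi> A < soft_max \<phi> A + e / (x \<bullet> x)" using \<open>0 < e\<close> by simp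
    from barrier_quadratic_form[OF barrier_above_soft_max[OF this], of x] False
    show ?thesis by (simp add: distrib_right)
  qed (use \<open>0 < e\<close> in simp)
qed

text \<open>Serves twice: with \<open>c\<close> the norm of a difference it yields the Lipschitz
  bound, and with \<open>c = 0\<close> it shows that subtracting a rank-one square cannot raise the
  soft edge.\<close>

lemma soft_max_le_add:
  fixes A B :: "real ^ 'n ^ 'n"
  assumes "\<And>x. x \<bullet> (B *v x) \<le> x \<bullet> (A *v x) + c * (x \<bullet> x)"
  shows "soft_max \<phi> B \<le> soft_max \<phi> A + c"
proof (rule field_le_epsilon)
  fix e :: real assume e: "0 < e"
  let ?u = "soft_max \<phi> A + e"
  have "barrier \<phi> (mat (?u + c) - symmetric_part B)"
  proof (rule barrier_mono[OF barrier_above_soft_max[of A ?u]])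
    fix x :: "real ^ 'n"
    show "x \<bullet> ((mat ?u - symmetric_part A) *v x) \<le> x \<bullet> ((mat (?u + c) - symmetric_part B) *v x)"
      using assms[of x] by (simp add: matrix_vector_mult_diff_rdistrib mat_vector_mult
          inner_diff_right quadratic_form_symmetric_part algebra_simps)
  qed (use e in \<open>auto simp: transpose_diff transpose_symmetric_part\<close>)
  from soft_max_le[OF this] show "soft_max \<phi> B \<le> soft_max \<phi> A + c + e" by simp
qed

lemma soft_max_lipschitz: "\<bar>soft_max \<phi> A - soft_max \<phi> B\<bar> \<le> norm (A - B)"
proof -
  have "soft_max \<phi> A \<le> soft_max \<phi> B + norm (A - B)" for A B :: "real ^ 'n ^ 'n"
  proof (rule soft_max_le_add)
    fix x :: "real ^ 'n"
    show "x \<bullet> (A *v x) \<le> x \<bullet> (B *v x) + norm (A - B) * (x \<bullet> x)"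
      using quadratic_form_le_norm[of x "A - B"]
      by (simp add: matrix_vector_mult_diff_rdistrib inner_diff_right)
  qed
  from this[of A B] this[of B A] show ?thesis by (simp add: norm_minus_commute abs_le_iff)
qed

lemma continuous_soft_max: "continuous_on UNIV (soft_max \<phi>)"
  unfolding continuous_on_iff
  by (metis UNIV_I dist_norm real_norm_def soft_max_lipschitz order.strict_trans1)

lemma soft_max_zero_le: "soft_max \<phi> (0 :: real ^ 'n ^ 'n) \<le> real CARD('n) / \<phi>"
  using soft_max_le[OF barrier_soft_max_ex[of 0]] by simp

end

subsection \<open>Extreme eigenvalues\<close>

text \<open>The largest eigenvalue of a symmetric matrix in a form that is visibly Lipschitz, hence
  measurable; \<open>Max (eigenvalues A)\<close> does not show this.\<close>

definition rayleigh_sup :: "real ^ 'n ^ 'n \<Rightarrow> real" where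
  "rayleigh_sup A = (SUP x\<in>sphere 0 1. x \<bullet> (A *v x))"

lemma rayleigh_sup_lipschitz: "\<bar>rayleigh_sup A - rayleigh_sup B\<bar> \<le> norm (A - B)"
  for A B :: "real ^ 'n ^ 'n"
proof -
  have le: "rayleigh_sup A \<le> rayleigh_sup B + norm (A - B)" for A B :: "real ^ 'n ^ 'n"
    unfolding rayleigh_sup_def
  proof (rule cSUP_least)
    show "sphere 0 1 \<noteq> ({} :: (real ^ 'n) set)" by simp
    fix x :: "real ^ 'n" assume x: "x \<in> sphere 0 1"
    then have xx: "x \<bullet> x = 1" by (simp add: norm_eq_1)
    have "bdd_above ((\<lambda>x. x \<bullet> (B *v x)) ` sphere 0 1)"
    proof (rule bdd_aboveI2)
      fix y :: "real ^ 'n" assume "y \<in> sphere 0 1"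
      then show "y \<bullet> (B *v y) \<le> norm B"
        using quadratic_form_le_norm[of y B] by (simp add: norm_eq_1)
    qed
    then have "x \<bullet> (B *v x) \<le> (SUP x\<in>sphere 0 1. x \<bullet> (B *v x))" using x by (rule cSUP_upper2) auto
    then show "x \<bullet> (A *v x) \<le> (SUP x\<in>sphere 0 1. x \<bullet> (B *v x)) + norm (A - B)"
      using quadratic_form_le_norm[of x "A - B"] xx
      by (simp add: matrix_vector_mult_diff_rdistrib inner_diff_right)
  qed
  from le[of A B] le[of B A] show ?thesis by (simp add: norm_minus_commute abs_le_iff)
qed

lemma continuous_rayleigh_sup: "continuous_on UNIV rayleigh_sup"
  unfolding continuous_on_iff
  by (metis UNIV_I dist_norm real_norm_def rayleigh_sup_lipschitz order.strict_trans1)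

lemma eigenvalues_eigenbasis:
  fixes v :: "'n \<Rightarrow> real ^ 'n"
  assumes v: "orthonormal v" and A: "\<And>i. A *v v i = l i *\<^sub>R v i"
  shows "eigenvalues A = range l"
proof (intro equalityI subsetI)
  fix k assume "k \<in> eigenvalues A"
  then obtain w where w: "w \<noteq> 0" "A *v w = k *\<^sub>R w" by (auto simp: eigenvalues_def)
  obtain i where i: "v i \<bullet> w \<noteq> 0" using orthonormal_nonzero_coordinate[OF v w(1)] by blast
  have "v i \<bullet> (A *v w) = l i * (v i \<bullet> w)"
    using v by (simp add: quadratic_form_eigenbasis(1)[OF v A] inner_sum_right orthonormal_def
        if_distrib[of "\<lambda>a. _ * a"] cong: if_cong)
  then show "k \<in> range l" using w i by auto
next
  fix k assume "k \<in> range l"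
  then obtain i where "k = l i" by blast
  moreover have "v i \<noteq> 0" using v by (metis inner_zero_left orthonormal_def zero_neq_one)
  ultimately show "k \<in> eigenvalues A" using A by (auto simp: eigenvalues_def)
qed

lemma lambda_max_eq_rayleigh_sup:
  fixes A :: "real ^ 'n ^ 'n"
  assumes sym: "transpose A = A"
  shows "lambda_max A = rayleigh_sup A"
proof -
  obtain v l where v: "orthonormal v" and A: "\<And>i. A *v v i = l i *\<^sub>R v i"
    using symmetric_eigenbasis[OF sym] by metis
  have "rayleigh_sup A = Max (range l)"
    unfolding rayleigh_sup_def
  proof (rule cSup_eq_maximum)
    have "Max (range l) \<in> range l" by (intro Max_in) auto
    then obtain i where i: "Max (range l) = l i" by blast
    have vi: "v i \<bullet> v i = 1" using v by (simp add: orthonormal_def)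
    show "Max (range l) \<in> (\<lambda>x. x \<bullet> (A *v x)) ` sphere 0 1"
    proof (rule image_eqI)
      show "Max (range l) = v i \<bullet> (A *v v i)" using i vi by (simp add: A)
    qed (use vi in \<open>simp add: norm_eq_1\<close>)
  next
    fix y assume "y \<in> (\<lambda>x. x \<bullet> (A *v x)) ` sphere 0 1"
    then obtain x where "x \<in> sphere 0 1" and y: "y = x \<bullet> (A *v x)" by blast
    then have x: "x \<bullet> x = 1" by (simp add: norm_eq_1)
    have "y = (\<Sum>i\<in>UNIV. l i * (v i \<bullet> x)\<^sup>2)"
      unfolding y by (rule quadratic_form_eigenbasis(2)[OF v A])
    also have "\<dots> \<le> (\<Sum>i\<in>UNIV. Max (range l) * (v i \<bullet> x)\<^sup>2)"
      by (intro sum_mono mult_right_mono Max_ge) auto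
    also have "\<dots> = Max (range l) * (x \<bullet> x)"
      by (subst orthonormal_parseval[OF v]) (simp only: sum_distrib_left power2_eq_square)
    also have "\<dots> = Max (range l)" by (simp add: x)
    finally show "y \<le> Max (range l)" .
  qed
  then show ?thesis by (simp add: lambda_max_def eigenvalues_eigenbasis[OF v A])
qed

lemma lambda_min_eq_rayleigh_sup:
  fixes A :: "real ^ 'n ^ 'n"
  assumes sym: "transpose A = A"
  shows "lambda_min A = - rayleigh_sup (- A)"
proof -
  obtain v l where v: "orthonormal v" and A: "\<And>i. A *v v i = l i *\<^sub>R v i"
    using symmetric_eigenbasis[OF sym] by metis
  have "eigenvalues (- A) = range (\<lambda>i. - l i)"
    by (intro eigenvalues_eigenbasis[OF v]) (simp add: matrix_vector_mult_uminus_left A)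
  also have "\<dots> = uminus ` eigenvalues A" by (auto simp: eigenvalues_eigenbasis[OF v A])
  finally have "lambda_max (- A) = - lambda_min A"
    by (simp add: lambda_max_def lambda_min_def eigenvalues_eigenbasis[OF v A] minus_Min_eq_Max)
  then show ?thesis
    using lambda_max_eq_rayleigh_sup[of "- A"] by (simp add: transpose_uminus sym)
qed

subsection \<open>Blocks of comparable eigenvalues\<close>

text \<open>Logarithmic bins of ratio e starting at the smallest value. For positive \<mu> the
  logarithm is nonnegative, so \<open>nat\<close> truncates nothing.\<close>

definition block :: "('n::finite \<Rightarrow> real) \<Rightarrow> 'n \<Rightarrow> nat" where
  "block \<mu> i = nat \<lfloor>ln (\<mu> i / Min (range \<mu>))\<rfloor>"

definition block_scale :: "('n::finite \<Rightarrow> real) \<Rightarrow> nat \<Rightarrow> real" where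
  "block_scale \<mu> k = exp (real k) * Min (range \<mu>)"

definition block_sum :: "('n::finite \<Rightarrow> real) \<Rightarrow> ('n \<Rightarrow> real) \<Rightarrow> nat \<Rightarrow> real" where
  "block_sum \<mu> a k = (\<Sum>i | block \<mu> i = k. a i)"

text \<open>For an overfull block \<open>k\<close>, the shift
  \<open>block_sum \<mu> a k / t k\<close> already pushes its contribution to the resolvent form
  down to \<open>t k\<close>; the sum of these shifts handles all overfull blocks at once.\<close>

definition excess :: "('n::finite \<Rightarrow> real) \<Rightarrow> (nat \<Rightarrow> real) \<Rightarrow> ('n \<Rightarrow> real) \<Rightarrow> real" where
  "excess \<mu> t a = (\<Sum>k\<in>range (block \<mu>).
     if t k * block_scale \<mu> k < block_sum \<mu> a k then block_sum \<mu> a k / t k else 0)"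

text \<open>The first summand makes the tail assumption applicable to the block; since the reciprocals
  of the eigenvalues sum to at most \<open>\<phi>\<close>, these summands add up to at most \<open>3 C \<phi>\<close>.\<close>

definition threshold :: "real \<Rightarrow> real \<Rightarrow> real \<Rightarrow> ('n::finite \<Rightarrow> real) \<Rightarrow> nat \<Rightarrow> real" where
  "threshold C \<theta> \<tau> \<mu> k = C * real (card {i. block \<mu> i = k}) / block_scale \<mu> k
     + \<tau> * (1 - exp (- \<theta>)) * exp (- \<theta> * real k)"

lemma block_scale_bounds:
  fixes \<mu> :: "'n::finite \<Rightarrow> real"
  assumes \<mu>: "\<And>i. 0 < \<mu> i"
  shows "0 < Min (range \<mu>)" "Min (range \<mu>) \<le> block_scale \<mu> k"
    "block_scale \<mu> (block \<mu> i) \<le> \<mu> i" "\<mu> i \<le> 3 * block_scale \<mu> (block \<mu> i)"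
proof -
  define m where "m = Min (range \<mu>)"
  have "m \<in> range \<mu>" unfolding m_def by (intro Min_in) auto
  then have m0: "0 < m" using \<mu> by auto
  then show "0 < Min (range \<mu>)" by (simp only: m_def)
  show "Min (range \<mu>) \<le> block_scale \<mu> k" using m0 by (simp add: block_scale_def m_def[symmetric])
  have "m \<le> \<mu> i" by (simp add: m_def)
  then have ge1: "1 \<le> \<mu> i / m" using m0 by (simp add: pos_le_divide_eq)
  define r where "r = ln (\<mu> i / m)"
  have r0: "0 \<le> r" using ge1 by (simp add: r_def ln_ge_zero)
  have b: "real (block \<mu> i) \<le> r" "r \<le> 1 + real (block \<mu> i)"
    using r0 by (auto simp: block_def r_def[symmetric] m_def[symmetric]) linarith
  have \<mu>r: "\<mu> i = exp r * m" using \<mu>[of i] m0 by (simp add: r_def)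
  show "block_scale \<mu> (block \<mu> i) \<le> \<mu> i"
    using b(1) m0 by (simp add: block_scale_def m_def[symmetric] \<mu>r)
  have "exp r \<le> exp 1 * exp (real (block \<mu> i))" using b(2) by (simp flip: exp_add)
  also have "\<dots> \<le> 3 * exp (real (block \<mu> i))" using exp_le by (intro mult_right_mono) auto
  finally show "\<mu> i \<le> 3 * block_scale \<mu> (block \<mu> i)"
    using m0 by (simp add: block_scale_def m_def[symmetric] \<mu>r)
qed

lemma sum_by_blocks:
  fixes g :: "'n::finite \<Rightarrow> real"
  shows "(\<Sum>i\<in>UNIV. g i) = (\<Sum>k\<in>range (block \<mu>). \<Sum>i | block \<mu> i = k. g i)"
  using sum.image_gen[of UNIV g "block \<mu>"] by simp

lemma resolvent_sum_le_block_sum: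
  fixes \<mu> a :: "'n::finite \<Rightarrow> real"
  assumes \<mu>: "\<And>i. 0 < \<mu> i" and a: "\<And>i. 0 \<le> a i" and d: "0 \<le> d"
  shows "(\<Sum>i\<in>UNIV. a i / (\<mu> i + d))
    \<le> (\<Sum>k\<in>range (block \<mu>). block_sum \<mu> a k / (block_scale \<mu> k + d))"
  unfolding sum_by_blocks[of _ \<mu>] block_sum_def sum_divide_distrib
proof (intro sum_mono)
  fix k i assume "i \<in> {i. block \<mu> i = k}"
  then have k: "block \<mu> i = k" by simp
  have "0 < block_scale \<mu> k" using block_scale_bounds(1,2)[OF \<mu>] by (rule less_le_trans)
  then show "a i / (\<mu> i + d) \<le> a i / (block_scale \<mu> k + d)"
    using block_scale_bounds(3)[of \<mu> i, OF \<mu>] a \<mu>[of i] d k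
    by (intro divide_left_mono mult_pos_pos) auto
qed

lemma excess_nonneg:
  assumes "\<And>k. 0 < t k" "\<And>i. 0 \<le> a i"
  shows "0 \<le> excess \<mu> t a"
  unfolding excess_def block_sum_def using assms
  by (intro sum_nonneg) (auto intro!: divide_nonneg_pos sum_nonneg)

text \<open>If no block is overfull, the resolvent form is at most the sum of the thresholds.
  Otherwise a single overfull block makes the excess at least the smallest eigenvalue, and shifting
  by the excess cures every block. The last conjunct is for the downward step, where the excess has
  to outweigh the average shift.\<close>

lemma excess_dichotomy:
  fixes \<mu> a :: "'n::finite \<Rightarrow> real"
  assumes \<mu>: "\<And>i. 0 < \<mu> i" and a: "\<And>i. 0 \<le> a i" and t: "\<And>k. 0 < t k"
    and s: "(\<Sum>k\<in>range (block \<mu>). t k) \<le> s" "s \<le> 1 / 2"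
  shows "(\<Sum>i\<in>UNIV. a i / \<mu> i) \<le> s \<or>
    Min (range \<mu>) \<le> excess \<mu> t a \<and> (\<Sum>i\<in>UNIV. a i / (\<mu> i + excess \<mu> t a)) \<le> s \<and>
    (\<Sum>i\<in>UNIV. a i / (\<mu> i)\<^sup>2) / (\<Sum>i\<in>UNIV. 1 / (\<mu> i)\<^sup>2) \<le> excess \<mu> t a"
proof (cases "\<forall>k\<in>range (block \<mu>). block_sum \<mu> a k \<le> t k * block_scale \<mu> k")
  case True
  have b0: "0 < block_scale \<mu> k" for k using block_scale_bounds(1,2)[OF \<mu>] by (rule less_le_trans)
  have "(\<Sum>i\<in>UNIV. a i / \<mu> i) \<le> (\<Sum>k\<in>range (block \<mu>). block_sum \<mu> a k / block_scale \<mu> k)"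
    using resolvent_sum_le_block_sum[of \<mu> a 0] \<mu> a by simp
  also have "\<dots> \<le> (\<Sum>k\<in>range (block \<mu>). t k)"
  proof (rule sum_mono)
    fix k assume "k \<in> range (block \<mu>)"
    then show "block_sum \<mu> a k / block_scale \<mu> k \<le> t k"
      using bspec[OF True, of k] b0[of k] by (simp add: pos_divide_le_eq)
  qed
  finally show ?thesis using s by linarith
next
  case False
  define m where "m = Min (range \<mu>)"
  define D where "D = excess \<mu> t a"
  have m0: "0 < m" unfolding m_def by (rule block_scale_bounds(1)[OF \<mu>])
  have b0: "0 < block_scale \<mu> k" for k using block_scale_bounds(1,2)[OF \<mu>] by (rule less_le_trans)
  have Z0: "0 \<le> block_sum \<mu> a k" for k unfolding block_sum_def using a by (intro sum_nonneg) auto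
  have D_ge: "block_sum \<mu> a k / t k \<le> D"
    if "k \<in> range (block \<mu>)" "t k * block_scale \<mu> k < block_sum \<mu> a k" for k
  proof -
    let ?h = "\<lambda>k. if t k * block_scale \<mu> k < block_sum \<mu> a k then block_sum \<mu> a k / t k else 0"
    have "?h k \<le> (\<Sum>k\<in>range (block \<mu>). ?h k)"
      using that(1) Z0 less_imp_le[OF t] by (intro member_le_sum) auto
    then show ?thesis using that(2) by (simp add: D_def excess_def)
  qed
  obtain k where k: "k \<in> range (block \<mu>)" "t k * block_scale \<mu> k < block_sum \<mu> a k"
    using False by (auto simp: not_le)
  have "block_scale \<mu> k \<le> block_sum \<mu> a k / t k"
    using k(2) t[of k] by (simp add: pos_le_divide_eq mult.commute)
  then have mD: "m \<le> D" using D_ge[OF k] block_scale_bounds(2)[where \<mu> = \<mu> and k = k, OF \<mu>] unfolding m_def by linarith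
  then have D0: "0 \<le> D" using m0 by linarith
  have "(\<Sum>i\<in>UNIV. a i / (\<mu> i + D))
      \<le> (\<Sum>k\<in>range (block \<mu>). block_sum \<mu> a k / (block_scale \<mu> k + D))"
    by (rule resolvent_sum_le_block_sum[OF \<mu> a D0])
  also have "\<dots> \<le> (\<Sum>k\<in>range (block \<mu>). t k)"
  proof (rule sum_mono)
    fix k assume kr: "k \<in> range (block \<mu>)"
    have "block_sum \<mu> a k \<le> t k * (block_scale \<mu> k + D)"
    proof (cases "t k * block_scale \<mu> k < block_sum \<mu> a k")
      case True
      then have "block_sum \<mu> a k \<le> t k * D"
        using D_ge[OF kr True] t[of k] by (simp add: pos_divide_le_eq mult.commute)
      also have "\<dots> \<le> t k * (block_scale \<mu> k + D)"
        using b0[of k] t[of k] by (intro mult_left_mono) auto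
      finally show ?thesis .
    next
      case False
      then have "block_sum \<mu> a k \<le> t k * block_scale \<mu> k" by simp
      also have "\<dots> \<le> t k * (block_scale \<mu> k + D)"
        using D0 t[of k] by (intro mult_left_mono) auto
      finally show ?thesis .
    qed
    then show "block_sum \<mu> a k / (block_scale \<mu> k + D) \<le> t k"
      using b0[of k] D0 by (simp add: pos_divide_le_eq add_pos_nonneg)
  qed
  finally have qs: "(\<Sum>i\<in>UNIV. a i / (\<mu> i + D)) \<le> s" using s(1) by linarith
  \<comment> \<open>Undoing the shift in the resolvent form costs the factor
    \<open>1 + D / m\<close>; then \<open>m \<le> D\<close> and \<open>s \<le> 1 / 2\<close> bring
    the product below \<open>D\<close>.\<close>
  have "(\<Sum>i\<in>UNIV. a i / (\<mu> i)\<^sup>2) / (\<Sum>i\<in>UNIV. 1 / (\<mu> i)\<^sup>2)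
      \<le> m * (\<Sum>i\<in>UNIV. a i / \<mu> i)"
    unfolding m_def by (rule inverse_square_average_le[OF \<mu> a])
  also have "\<dots> \<le> m * (\<Sum>i\<in>UNIV. (1 + D / m) * (a i / (\<mu> i + D)))"
  proof (intro mult_left_mono sum_mono)
    fix i
    have "D \<le> D / m * \<mu> i"
    proof -
      have "m \<le> \<mu> i" by (simp add: m_def)
      then have "D / m * m \<le> D / m * \<mu> i" using D0 m0 by (intro mult_left_mono) auto
      then show ?thesis using m0 by simp
    qed
    then have "\<mu> i + D \<le> (1 + D / m) * \<mu> i" by (simp add: distrib_right)
    then have "a i * (\<mu> i + D) \<le> a i * ((1 + D / m) * \<mu> i)" using a by (intro mult_left_mono) auto
    then show "a i / \<mu> i \<le> (1 + D / m) * (a i / (\<mu> i + D))"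
      using \<mu>[of i] D0 by (simp add: pos_divide_le_eq pos_le_divide_eq mult_ac)
  qed (use m0 in simp)
  also have "\<dots> = (m + D) * (\<Sum>i\<in>UNIV. a i / (\<mu> i + D))"
  proof -
    have "m * (1 + D / m) = m + D" using m0 by (simp add: distrib_left)
    then show ?thesis by (simp only: sum_distrib_left[symmetric] mult.assoc[symmetric])
  qed
  also have "\<dots> \<le> (D + D) * (1 / 2)"
    using qs s(2) mD m0 D0 a \<mu>
    by (intro mult_mono sum_nonneg divide_nonneg_nonneg add_nonneg_nonneg) (auto simp: less_imp_le)
  finally show ?thesis using mD qs by (simp add: D_def m_def)
qed

section \<open>Geometric sums and the size of the thresholds\<close>

lemma sum_powers_le:
  fixes r :: real
  assumes "finite K" "0 \<le> r" "r < 1"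
  shows "(\<Sum>k\<in>K. r ^ k) \<le> 1 / (1 - r)"
proof -
  have "(\<Sum>k\<in>K. r ^ k) \<le> (\<Sum>k. r ^ k)"
    using assms by (intro sum_le_suminf summable_geometric) auto
  then show ?thesis using assms by (simp add: suminf_geometric)
qed

lemma sum_exp_le:
  fixes x :: real
  assumes "finite K" "0 < x"
  shows "(\<Sum>k\<in>K. exp (- x * real k)) \<le> 1 / (1 - exp (- x))"
  using sum_powers_le[of K "exp (- x)"] assms by (simp add: exp_of_nat_mult[symmetric] mult.commute)

lemma threshold_pos:
  fixes \<mu> :: "'n::finite \<Rightarrow> real"
  assumes \<mu>: "\<And>i. 0 < \<mu> i" and C: "0 < C" "0 < \<theta>" "0 < \<tau>"
  shows "0 < threshold C \<theta> \<tau> \<mu> k"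
    "C * real (card {i. block \<mu> i = k}) < threshold C \<theta> \<tau> \<mu> k * block_scale \<mu> k"
    "\<tau> * (1 - exp (- \<theta>)) * exp (- \<theta> * real k) \<le> threshold C \<theta> \<tau> \<mu> k"
proof -
  have b0: "0 < block_scale \<mu> k" using block_scale_bounds(1,2)[OF \<mu>] by (rule less_le_trans)
  have g0: "0 < \<tau> * (1 - exp (- \<theta>)) * exp (- \<theta> * real k)" using C by simp
  show le: "\<tau> * (1 - exp (- \<theta>)) * exp (- \<theta> * real k) \<le> threshold C \<theta> \<tau> \<mu> k"
    using b0 C by (simp add: threshold_def)
  with g0 show "0 < threshold C \<theta> \<tau> \<mu> k" by linarith
  have "threshold C \<theta> \<tau> \<mu> k * block_scale \<mu> k = C * real (card {i. block \<mu> i = k})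
      + \<tau> * (1 - exp (- \<theta>)) * exp (- \<theta> * real k) * block_scale \<mu> k"
    using b0 by (simp add: threshold_def distrib_right)
  then show "C * real (card {i. block \<mu> i = k}) < threshold C \<theta> \<tau> \<mu> k * block_scale \<mu> k"
    using mult_pos_pos[OF g0 b0] by linarith
qed

lemma sum_threshold_le:
  fixes \<mu> :: "'n::finite \<Rightarrow> real"
  assumes \<mu>: "\<And>i. 0 < \<mu> i" and C: "0 < C" "0 < \<theta>" "0 < \<tau>"
    and \<phi>: "(\<Sum>i\<in>UNIV. 1 / \<mu> i) \<le> \<phi>"
  shows "(\<Sum>k\<in>range (block \<mu>). threshold C \<theta> \<tau> \<mu> k) \<le> 3 * C * \<phi> + \<tau>"
proof -
  have b0: "0 < block_scale \<mu> k" for k using block_scale_bounds(1,2)[OF \<mu>] by (rule less_le_trans)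
  have "(\<Sum>k\<in>range (block \<mu>). C * real (card {i. block \<mu> i = k}) / block_scale \<mu> k)
      = (\<Sum>k\<in>range (block \<mu>). \<Sum>i | block \<mu> i = k. C / block_scale \<mu> (block \<mu> i))"
    by (intro sum.cong) auto
  also have "\<dots> = (\<Sum>i\<in>UNIV. C / block_scale \<mu> (block \<mu> i))"
    by (rule sum_by_blocks[symmetric])
  \<comment> \<open>An eigenvalue exceeds the scale of its block at most by the factor 3, a bound
    for e.\<close>
  also have "\<dots> \<le> (\<Sum>i\<in>UNIV. 3 * C * (1 / \<mu> i))"
  proof (rule sum_mono)
    fix i
    show "C / block_scale \<mu> (block \<mu> i) \<le> 3 * C * (1 / \<mu> i)"
      using block_scale_bounds(4)[of \<mu> i, OF \<mu>] b0[of "block \<mu> i"] \<mu>[of i] C(1)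
      by (simp add: pos_divide_le_eq pos_le_divide_eq mult_left_mono)
  qed
  also have "\<dots> \<le> 3 * C * \<phi>"
    unfolding sum_distrib_left[symmetric] using \<phi> C by (intro mult_left_mono) auto
  finally have 1: "(\<Sum>k\<in>range (block \<mu>). C * real (card {i. block \<mu> i = k}) / block_scale \<mu> k)
      \<le> 3 * C * \<phi>" .
  have "(\<Sum>k\<in>range (block \<mu>). \<tau> * (1 - exp (- \<theta>)) * exp (- \<theta> * real k))
      \<le> \<tau> * (1 - exp (- \<theta>)) * (1 / (1 - exp (- \<theta>)))"
    unfolding sum_distrib_left[symmetric] using C by (intro mult_left_mono sum_exp_le) auto
  also have "\<dots> = \<tau>" using C by simp
  finally show ?thesis using 1 by (simp add: threshold_def sum.distrib)
qed

text \<open>The exponent \<open>\<theta> = \<eta> / (2 (1 + \<eta>))\<close> makes the summands decay like \<open>exp (- k \<eta> / 2)\<close>,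
  while the thresholds remain summable.\<close>

lemma sum_threshold_powr_le:
  fixes \<mu> :: "'n::finite \<Rightarrow> real"
  assumes \<mu>: "\<And>i. 0 < \<mu> i" and C: "0 < C" "0 < \<eta>" "0 < \<tau>"
    and \<phi>: "(\<Sum>i\<in>UNIV. 1 / \<mu> i) \<le> \<phi>" and \<theta>: "\<theta> = \<eta> / (2 * (1 + \<eta>))"
  shows "(\<Sum>k\<in>range (block \<mu>). threshold C \<theta> \<tau> \<mu> k powr (- 1 - \<eta>) * block_scale \<mu> k powr (- \<eta>))
    \<le> (\<tau> * (1 - exp (- \<theta>))) powr (- 1 - \<eta>) * \<phi> powr \<eta> * (1 / (1 - exp (- \<eta> / 2)))"
proof -
  define m where "m = Min (range \<mu>)"
  define g where "g = \<tau> * (1 - exp (- \<theta>))"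
  have \<theta>0: "0 < \<theta>" using C by (simp add: \<theta>)
  have g0: "0 < g" using C \<theta>0 by (simp add: g_def)
  have m0: "0 < m" unfolding m_def by (rule block_scale_bounds(1)[OF \<mu>])
  \<comment> \<open>The smallest eigenvalue contributes \<open>1 / m\<close> to the trace. This is
    how a small \<phi> pushes all block scales up and makes overfull blocks unlikely.\<close>
  have "1 / m \<le> \<phi>"
  proof -
    have "m \<in> range \<mu>" unfolding m_def by (intro Min_in) auto
    then obtain i where i: "m = \<mu> i" by blast
    have "0 \<le> 1 / \<mu> i" for i using \<mu>[of i] by simp
    then have "1 / \<mu> i \<le> (\<Sum>i\<in>UNIV. 1 / \<mu> i)" by (intro member_le_sum) auto
    then show ?thesis using \<phi> i by simp
  qed
  then have "(1 / m) powr \<eta> \<le> \<phi> powr \<eta>" using m0 C by (intro powr_mono2) auto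
  then have m\<phi>: "m powr (- \<eta>) \<le> \<phi> powr \<eta>" using m0 by (simp add: powr_divide powr_minus_divide)
  have "threshold C \<theta> \<tau> \<mu> k powr (- 1 - \<eta>) * block_scale \<mu> k powr (- \<eta>)
      \<le> g powr (- 1 - \<eta>) * \<phi> powr \<eta> * exp (- (\<eta> / 2) * real k)" for k
  proof -
    have "threshold C \<theta> \<tau> \<mu> k powr (- 1 - \<eta>) \<le> (g * exp (- \<theta> * real k)) powr (- 1 - \<eta>)"
      using threshold_pos(3)[of \<mu> C \<theta> \<tau> k, OF \<mu> C(1) \<theta>0 C(3)] g0 C
      by (intro powr_mono2') (auto simp: g_def)
    also have "\<dots> = g powr (- 1 - \<eta>) * exp (\<theta> * (1 + \<eta>) * real k)"
    proof -
      have "exp (- \<theta> * real k) powr (- 1 - \<eta>) = exp (\<theta> * (1 + \<eta>) * real k)"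
        by (simp add: powr_def algebra_simps)
      then show ?thesis by (simp only: powr_mult)
    qed
    also have "\<theta> * (1 + \<eta>) = \<eta> / 2"
      using C nonzero_mult_divide_mult_cancel_right[of "1 + \<eta>" \<eta> 2] by (simp only: \<theta> times_divide_eq_left)
    finally have 1: "threshold C \<theta> \<tau> \<mu> k powr (- 1 - \<eta>) \<le> g powr (- 1 - \<eta>) * exp (\<eta> / 2 * real k)" .
    have "block_scale \<mu> k powr (- \<eta>) = exp (- \<eta> * real k) * m powr (- \<eta>)"
      using m0 by (simp add: block_scale_def m_def[symmetric] powr_mult) (simp add: powr_def)
    also have "\<dots> \<le> exp (- \<eta> * real k) * \<phi> powr \<eta>" using m\<phi> by (intro mult_left_mono) auto
    finally have 2: "block_scale \<mu> k powr (- \<eta>) \<le> exp (- \<eta> * real k) * \<phi> powr \<eta>" .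
    have "threshold C \<theta> \<tau> \<mu> k powr (- 1 - \<eta>) * block_scale \<mu> k powr (- \<eta>)
        \<le> (g powr (- 1 - \<eta>) * exp (\<eta> / 2 * real k)) * (exp (- \<eta> * real k) * \<phi> powr \<eta>)"
      using 1 2 by (intro mult_mono) auto
    also have "\<dots> = g powr (- 1 - \<eta>) * \<phi> powr \<eta> * (exp (\<eta> / 2 * real k) * exp (- \<eta> * real k))"
      by (simp only: mult_ac)
    also have "exp (\<eta> / 2 * real k) * exp (- \<eta> * real k) = exp (- (\<eta> / 2) * real k)"
      by (simp add: field_simps flip: exp_add)
    finally show ?thesis .
  qed
  then have "(\<Sum>k\<in>range (block \<mu>). threshold C \<theta> \<tau> \<mu> k powr (- 1 - \<eta>) * block_scale \<mu> k powr (- \<eta>))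
      \<le> (\<Sum>k\<in>range (block \<mu>). g powr (- 1 - \<eta>) * \<phi> powr \<eta> * exp (- (\<eta> / 2) * real k))"
    by (intro sum_mono) auto
  also have "\<dots> \<le> g powr (- 1 - \<eta>) * \<phi> powr \<eta> * (1 / (1 - exp (- (\<eta> / 2))))"
    unfolding sum_distrib_left[symmetric] using C by (intro mult_left_mono sum_exp_le) auto
  finally show ?thesis by (simp add: g_def)
qed

subsection \<open>The choice of constants\<close>

text \<open>The classical bound by e, rounded up. It controls factors
  \<open>(1 + 1 / \<eta>) powr \<eta>\<close> uniformly in \<eta>.\<close>

lemma one_plus_inverse_powr_le:
  fixes x :: real
  assumes "0 < x"
  shows "(1 + 1 / x) powr x \<le> 3"
proof -
  have "ln (1 + 1 / x) \<le> 1 / x" using assms by (intro ln_add_one_self_le_self) auto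
  then have "x * ln (1 + 1 / x) \<le> 1" using assms by (simp add: pos_le_divide_eq mult.commute)
  moreover have "0 < 1 + 1 / x" using assms by (simp add: add_pos_pos)
  ultimately have "(1 + 1 / x) powr x \<le> exp 1" unfolding powr_def by simp
  then show ?thesis using exp_le by linarith
qed

context
  fixes C \<eta> G K \<epsilon> \<phi> :: real
  assumes C: "0 < C" and \<eta>: "0 < \<eta>" and G: "G = 6 + 6 / \<eta>" and CG: "2 \<le> C * G"
    and K: "K = 512 * (16 * C) powr (1 + 2 / \<eta>) * G powr (1 + 4 / \<eta>)"
    and \<epsilon>: "0 < \<epsilon>" "\<epsilon> \<le> 1" and \<phi>: "\<phi> = \<epsilon> powr (1 + 2 / \<eta>) / K"
begin

lemma G_ge: "6 \<le> G" using \<eta> by (simp add: G)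

text \<open>Regrouping \<open>K\<close> as \<open>512 * 16 * C * G\<close> times
  \<open>(16 * C * G * G) powr (2 / \<eta>)\<close> makes the base of the power at least 1. Only the
  product \<open>C * G\<close> is bounded below; \<open>C\<close> itself may be small when \<eta>
  is.\<close>

lemma K_ge: "16384 \<le> K" "512 * 16 * C \<le> K"
proof -
  have "(1::real) \<le> (16 * C * G * G) powr (2 / \<eta>)"
  proof (rule ge_one_powr_ge_zero)
    have "1 * 1 \<le> (16 * (C * G)) * G" using CG G_ge by (intro mult_mono) auto
    then show "1 \<le> 16 * C * G * G" by (simp add: mult.assoc)
  qed (use \<eta> in simp)
  moreover have "K = 512 * 16 * C * G * (16 * C * G * G) powr (2 / \<eta>)"
  proof -
    have "G powr (4 / \<eta>) = G powr (2 / \<eta>) * G powr (2 / \<eta>)" by (simp flip: powr_add)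
    then show ?thesis unfolding K using C G_ge by (simp add: powr_add powr_mult)
  qed
  moreover have "0 \<le> 512 * 16 * C * G" using C G_ge by simp
  ultimately have le: "512 * 16 * C * G * 1 \<le> K" by (simp only:) (intro mult_left_mono)
  then show "16384 \<le> K" using CG by simp
  have "512 * 16 * C * 1 \<le> 512 * 16 * C * G" using C G_ge by (intro mult_left_mono) auto
  with le show "512 * 16 * C \<le> K" by simp
qed

lemma \<phi>_pos: "0 < \<phi>" using K_ge \<epsilon> by (simp add: \<phi>)

text \<open>The thresholds will sum to at most \<open>3 * C * \<phi> + \<epsilon> / 16\<close>; this
  makes the first summand at most \<open>\<epsilon> / 16\<close> too, for a total of
  \<open>\<epsilon> / 8\<close>.\<close>

lemma threshold_budget: "48 * C * \<phi> \<le> \<epsilon>"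
proof -
  have "\<epsilon> powr (1 + 2 / \<eta>) \<le> \<epsilon> powr 1" using \<epsilon> \<eta> by (intro powr_mono') auto
  then have "48 * C * \<epsilon> powr (1 + 2 / \<eta>) \<le> K * \<epsilon>" using K_ge C \<epsilon> by (intro mult_mono) auto
  then show ?thesis using K_ge by (simp add: \<phi> pos_divide_le_eq mult.commute)
qed

text \<open>What remains of the excess estimate after the powers of \<epsilon> cancel. The exponents
  in \<open>K\<close> are such that \<open>K powr \<eta>\<close> contains
  \<open>(16 * C)\<^sup>2\<close> and \<open>G ^ 4\<close> besides powers with exponent \<eta>;
  these beat the \<open>C * G ^ 3\<close> on the left.\<close>

lemma K_powr_ge: "C * G\<^sup>2 * (8 * G) powr (1 + \<eta>) \<le> 9 * K powr \<eta>"
proof -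
  have G0: "0 < G" using G_ge by simp
  have G\<eta>: "G powr \<eta> \<le> 3 * 6 powr \<eta>"
  proof -
    have "G = 6 * (1 + 1 / \<eta>)" by (simp add: G)
    then have "G powr \<eta> = 6 powr \<eta> * (1 + 1 / \<eta>) powr \<eta>"
      using \<eta> by (simp only:) (rule powr_mult)
    also have "\<dots> \<le> 6 powr \<eta> * 3" using \<eta> by (intro mult_left_mono one_plus_inverse_powr_le) auto
    finally show ?thesis by simp
  qed
  define p c g where "p = 8 powr \<eta>" and "c = (1024 * C) powr \<eta>" and "g = G powr \<eta>"
  have pos: "0 < p" "0 < c" "0 < g" using C G0 by (simp_all add: p_def c_def g_def)
  \<comment> \<open>\<open>G powr \<eta>\<close> is at most 3 times \<open>6 powr \<eta>\<close>, so
    the lower bound on \<open>C * G\<close> lets \<open>G\<close> cancel and keeps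
    \<open>(1024 * C) powr \<eta>\<close> above 1/3, however small \<open>C\<close> is.\<close>
  have "6 powr \<eta> \<le> (1024 * (C * G)) powr \<eta>" using CG \<eta> by (intro powr_mono2) auto
  also have "\<dots> = c * g" unfolding c_def g_def using C G0 by (simp add: powr_mult)
  finally have "6 powr \<eta> \<le> c * g" .
  moreover have "g \<le> 3 * 6 powr \<eta>" using G\<eta> by (simp add: g_def)
  ultimately have "g * 1 \<le> g * (3 * c)" by (simp add: mult_ac)
  then have c3: "1 \<le> 3 * c" using pos by simp
  have "K powr \<eta> = (512 powr \<eta> * (16 * C) powr \<eta>) * (16 * C)\<^sup>2 * g * G ^ 4"
  proof -
    have "(1 + 2 / \<eta>) * \<eta> = \<eta> + 2" "(1 + 4 / \<eta>) * \<eta> = \<eta> + 4"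
      using \<eta> by (simp_all add: distrib_right)
    then have "((16 * C) powr (1 + 2 / \<eta>)) powr \<eta> = (16 * C) powr (\<eta> + 2)"
      "(G powr (1 + 4 / \<eta>)) powr \<eta> = G powr (\<eta> + 4)"
      by (simp_all only: powr_powr)
    then have "((16 * C) powr (1 + 2 / \<eta>)) powr \<eta> = (16 * C) powr \<eta> * (16 * C)\<^sup>2"
      "(G powr (1 + 4 / \<eta>)) powr \<eta> = g * G ^ 4"
      using C G0 by (simp_all only: powr_add g_def) simp_all
    then show ?thesis
      unfolding K powr_mult[of "512 * (16 * C) powr (1 + 2 / \<eta>)"] powr_mult[of 512]
      by (simp only: mult.assoc)
  qed
  also have "512 powr \<eta> * (16 * C) powr \<eta> = p * c"
    unfolding p_def c_def using C by (simp flip: powr_mult)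
  finally have K\<eta>: "K powr \<eta> = p * c * (16 * C)\<^sup>2 * g * G ^ 4" .
  have "1 * 2 \<le> (3 * c) * (C * G)" using c3 CG by (intro mult_mono) auto
  then have "2 \<le> 3 * (c * (C * G))" by (simp only: mult.assoc mult_1)
  then have "8 \<le> 2304 * (c * (C * G))" by linarith
  then have "(C * G ^ 3 * p * g) * 8 \<le> (C * G ^ 3 * p * g) * (2304 * (c * (C * G)))"
    using C G0 pos by (intro mult_left_mono) auto
  moreover have "C * G\<^sup>2 * (8 * G) powr (1 + \<eta>) = (C * G ^ 3 * p * g) * 8"
    using G0 by (simp add: powr_add powr_mult p_def g_def power2_eq_square power3_eq_cube)
  moreover have "9 * K powr \<eta> = (C * G ^ 3 * p * g) * (2304 * (c * (C * G)))"
    unfolding K\<eta> by (simp add: power2_eq_square power3_eq_cube power4_eq_xxxx)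
  ultimately show ?thesis by (simp only:)
qed

text \<open>\<open>G\<close> is the common unit for the factors depending on \<eta>:
  \<open>1 + 1 / \<eta>\<close> is \<open>G / 6\<close>, \<theta> is \<open>3 / G\<close>, and the
  two differences \<open>1 - exp (- \<theta>)\<close> and \<open>1 - exp (- \<eta> / 2)\<close> are
  at least \<open>2 / G\<close> and \<open>3 / G\<close>. By the exponent in \<phi>,
  \<open>\<phi> powr \<eta>\<close> is \<open>\<epsilon> powr (2 + \<eta>) / K powr \<eta>\<close>,
  so a single factor \<epsilon> survives.\<close>

lemma excess_budget:
  fixes \<theta> :: real
  assumes \<theta>: "\<theta> = \<eta> / (2 * (1 + \<eta>))"
  shows "C * (1 + 1 / \<eta>) * ((\<epsilon> / 16 * (1 - exp (- \<theta>))) powr (- 1 - \<eta>) * \<phi> powr \<eta>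
    * (1 / (1 - exp (- \<eta> / 2)))) \<le> \<epsilon> / 2"
proof -
  have G0: "0 < G" using G_ge by simp
  have K0: "0 < K" using K_ge by simp
  have one_minus_exp: "x / (1 + x) \<le> 1 - exp (- x)" if "0 < x" for x :: real
  proof -
    have "1 + x \<le> exp x" by (rule exp_ge_add_one_self)
    then have "exp (- x) \<le> 1 / (1 + x)" using that by (simp add: exp_minus divide_inverse le_imp_inverse_le)
    moreover have "x / (1 + x) = 1 - 1 / (1 + x)" using that by (simp add: field_simps)
    ultimately show ?thesis by simp
  qed
  have \<theta>G: "\<theta> = 3 / G" using \<eta> by (simp add: \<theta> G field_simps)
  \<comment> \<open>This amounts to \<open>6 \<le> G\<close>.\<close>
  have "2 / G \<le> \<theta> / (1 + \<theta>)"
    using G_ge G0 by (simp add: \<theta>G field_simps)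
  also have "\<dots> \<le> 1 - exp (- \<theta>)" using G0 by (intro one_minus_exp) (simp add: \<theta>G)
  finally have "\<epsilon> / 16 * (2 / G) \<le> \<epsilon> / 16 * (1 - exp (- \<theta>))" using \<epsilon> by (intro mult_left_mono) auto
  then have "(\<epsilon> / 16 * (1 - exp (- \<theta>))) powr (- 1 - \<eta>) \<le> (\<epsilon> / (8 * G)) powr (- 1 - \<eta>)"
    using \<epsilon> G0 \<eta> by (intro powr_mono2') auto
  also have "\<dots> = (8 * G / \<epsilon>) powr (1 + \<eta>)"
  proof -
    have "(\<epsilon> / (8 * G)) powr (- 1 - \<eta>) = (\<epsilon> / (8 * G)) powr (- (1 + \<eta>))" by simp
    also have "\<dots> = (8 * G / \<epsilon>) powr (1 + \<eta>)"
      using \<epsilon> G0 by (simp only: powr_minus) (simp add: powr_divide)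
    finally show ?thesis .
  qed
  also have "\<dots> = (8 * G) powr (1 + \<eta>) / \<epsilon> powr (1 + \<eta>)" using \<epsilon> G0 by (simp add: powr_divide)
  finally have 1: "(\<epsilon> / 16 * (1 - exp (- \<theta>))) powr (- 1 - \<eta>)
      \<le> (8 * G) powr (1 + \<eta>) / \<epsilon> powr (1 + \<eta>)" .
  have "(1 + 2 / \<eta>) * \<eta> = 1 + \<eta> + 1" using \<eta> by (simp add: distrib_right)
  then have "(\<epsilon> powr (1 + 2 / \<eta>)) powr \<eta> = \<epsilon> powr (1 + \<eta>) * \<epsilon>"
    using \<epsilon> by (simp only: powr_powr powr_add[of \<epsilon> "1 + \<eta>" 1] powr_one)
  then have 2: "\<phi> powr \<eta> = \<epsilon> powr (1 + \<eta>) * \<epsilon> / K powr \<eta>"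
    unfolding \<phi> by (simp only: powr_divide)
  have "3 / G \<le> 1 - exp (- \<eta> / 2)"
  proof -
    have "3 / G \<le> (\<eta> / 2) / (1 + \<eta> / 2)" using \<eta> by (simp add: G field_simps)
    also have "\<dots> \<le> 1 - exp (- (\<eta> / 2))" using \<eta> by (intro one_minus_exp) auto
    finally show ?thesis by simp
  qed
  then have "1 / (1 - exp (- \<eta> / 2)) \<le> 1 / (3 / G)" using G0 \<eta> by (intro divide_left_mono) auto
  then have 3: "1 / (1 - exp (- \<eta> / 2)) \<le> G / 3" by simp
  have "C * (1 + 1 / \<eta>) * ((\<epsilon> / 16 * (1 - exp (- \<theta>))) powr (- 1 - \<eta>) * \<phi> powr \<eta>
      * (1 / (1 - exp (- \<eta> / 2))))
    \<le> C * (G / 6) * ((8 * G) powr (1 + \<eta>) / \<epsilon> powr (1 + \<eta>) * (\<epsilon> powr (1 + \<eta>) * \<epsilon> / K powr \<eta>) * (G / 3))"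
    using 1 3 C \<eta> \<epsilon> G0 unfolding 2 by (intro mult_mono mult_nonneg_nonneg) (auto simp: G)
  also have "\<dots> = C * G\<^sup>2 * (8 * G) powr (1 + \<eta>) * (\<epsilon> / (18 * K powr \<eta>))"
    using \<epsilon> K0 by (simp add: power2_eq_square)
  also have "\<dots> \<le> 9 * K powr \<eta> * (\<epsilon> / (18 * K powr \<eta>))"
    using K_powr_ge \<epsilon> K0 by (intro mult_right_mono) auto
  also have "\<dots> = \<epsilon> / 2" using K0 by simp
  finally show ?thesis .
qed

end

subsection \<open>Expectations under the tail condition\<close>

text \<open>Layer-cake formula: by Fubini the expectation is the integral of the tail probability
  over \<open>{t0..}\<close>, and the power bound integrates explicitly.\<close>

lemma (in prob_space) expectation_tail_excess:
  fixes Z :: "'a \<Rightarrow> real"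
  assumes Z: "integrable M Z" and C: "0 < C" "0 < \<eta>" "0 < t0"
    and tail: "\<And>t. t0 \<le> t \<Longrightarrow> prob {\<omega> \<in> space M. t < Z \<omega>} \<le> C * t powr (- 1 - \<eta>)"
  shows "expectation (\<lambda>\<omega>. max (Z \<omega> - t0) 0) \<le> C / \<eta> * t0 powr (- \<eta>)"
proof -
  have [measurable]: "Z \<in> borel_measurable M" using Z by auto
  interpret P: pair_sigma_finite M lborel ..
  let ?f = "\<lambda>\<omega> t. indicator {t0..} t * (if t < Z \<omega> then 1 else 0) :: ennreal"
  have slice: "ennreal (max (Z \<omega> - t0) 0) = (\<integral>\<^sup>+t. ?f \<omega> t \<partial>lborel)" for \<omega>
  proof -
    have "(\<integral>\<^sup>+t. ?f \<omega> t \<partial>lborel) = (\<integral>\<^sup>+t. indicator {t0..<Z \<omega>} t \<partial>lborel)"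
      by (intro nn_integral_cong) (auto simp: indicator_def)
    also have "\<dots> = ennreal (max (Z \<omega> - t0) 0)"
      by (cases "t0 \<le> Z \<omega>") (auto simp: max_def)
    finally show ?thesis by simp
  qed
  have "ennreal (expectation (\<lambda>\<omega>. max (Z \<omega> - t0) 0)) = (\<integral>\<^sup>+\<omega>. ennreal (max (Z \<omega> - t0) 0) \<partial>M)"
    using Z by (intro nn_integral_eq_integral[symmetric]) auto
  also have "\<dots> = (\<integral>\<^sup>+t. (\<integral>\<^sup>+\<omega>. ?f \<omega> t \<partial>M) \<partial>lborel)"
    unfolding slice by (rule P.Fubini'[symmetric]) measurable
  also have "\<dots> \<le> (\<integral>\<^sup>+t. ennreal (C * t powr (- 1 - \<eta>)) * indicator {t0..} t \<partial>lborel)"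
  proof (intro nn_integral_mono)
    fix t
    have "(\<integral>\<^sup>+\<omega>. ?f \<omega> t \<partial>M) = indicator {t0..} t * (\<integral>\<^sup>+\<omega>. indicator {\<omega> \<in> space M. t < Z \<omega>} \<omega> \<partial>M)"
      by (subst nn_integral_cmult[symmetric]) (auto intro!: nn_integral_cong simp: indicator_def)
    also have "\<dots> = indicator {t0..} t * ennreal (prob {\<omega> \<in> space M. t < Z \<omega>})"
      by (simp add: emeasure_eq_measure)
    also have "\<dots> \<le> ennreal (C * t powr (- 1 - \<eta>)) * indicator {t0..} t"
      using tail by (auto simp: indicator_def intro!: ennreal_leI)
    finally show "(\<integral>\<^sup>+\<omega>. ?f \<omega> t \<partial>M) \<le> ennreal (C * t powr (- 1 - \<eta>)) * indicator {t0..} t" .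
  qed
  also have "\<dots> = ennreal (0 - (- (C / \<eta> * t0 powr (- \<eta>))))"
  proof (rule nn_integral_FTC_atLeast)
    fix t assume "t0 \<le> t"
    then have t: "0 < t" using C by linarith
    show "((\<lambda>t. - (C / \<eta> * t powr (- \<eta>))) has_real_derivative C * t powr (- 1 - \<eta>)) (at t)"
      using t C by (auto intro!: derivative_eq_intros simp: minus_diff_commute[of \<eta> 1])
    show "0 \<le> C * t powr (- 1 - \<eta>)" using C by simp
  next
    have "((\<lambda>t. t powr (- \<eta>)) \<longlongrightarrow> 0) at_top"
      using C by (intro tendsto_neg_powr filterlim_ident) auto
    from tendsto_mult_right_zero[OF this, of "- (C / \<eta>)"]
    show "((\<lambda>t. - (C / \<eta> * t powr (- \<eta>))) \<longlongrightarrow> 0) at_top" by simp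
  qed simp
  finally show ?thesis using C by simp
qed

text \<open>Beyond the cut-off, \<open>Z\<close> is its excess over \<open>t0\<close> plus
  \<open>t0\<close> itself. The second part, estimated by the tail at \<open>t0\<close>, is the 1 in
  \<open>1 + 1 / \<eta>\<close>.\<close>

lemma (in prob_space) expectation_tail_part:
  fixes Z :: "'a \<Rightarrow> real"
  assumes Z: "integrable M Z" and C: "0 < C" "0 < \<eta>" "0 < t0"
    and tail: "\<And>t. t0 \<le> t \<Longrightarrow> prob {\<omega> \<in> space M. t < Z \<omega>} \<le> C * t powr (- 1 - \<eta>)"
  shows "integrable M (\<lambda>\<omega>. if t0 < Z \<omega> then Z \<omega> else 0)"
    "expectation (\<lambda>\<omega>. if t0 < Z \<omega> then Z \<omega> else 0) \<le> C * (1 + 1 / \<eta>) * t0 powr (- \<eta>)"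
proof -
  have [measurable]: "Z \<in> borel_measurable M" using Z by auto
  let ?A = "{\<omega> \<in> space M. t0 < Z \<omega>}"
  show "integrable M (\<lambda>\<omega>. if t0 < Z \<omega> then Z \<omega> else 0)"
    by (rule Bochner_Integration.integrable_bound[OF Z]) auto
  have "expectation (\<lambda>\<omega>. if t0 < Z \<omega> then Z \<omega> else 0)
      = expectation (\<lambda>\<omega>. max (Z \<omega> - t0) 0 + t0 * indicator ?A \<omega>)"
    by (intro Bochner_Integration.integral_cong) (auto simp: indicator_def)
  also have "\<dots> = expectation (\<lambda>\<omega>. max (Z \<omega> - t0) 0) + t0 * prob ?A"
    using Z by (subst Bochner_Integration.integral_add) (auto simp: emeasure_eq_measure)
  also have "\<dots> \<le> C / \<eta> * t0 powr (- \<eta>) + t0 * (C * t0 powr (- 1 - \<eta>))"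
    using C tail[of t0] by (intro add_mono mult_left_mono expectation_tail_excess[OF Z C tail]) auto
  also have "t0 * (C * t0 powr (- 1 - \<eta>)) = C * t0 powr (- \<eta>)"
    using C powr_add[of t0 1 "- 1 - \<eta>"] by (simp add: mult_ac)
  finally show "expectation (\<lambda>\<omega>. if t0 < Z \<omega> then Z \<omega> else 0) \<le> C * (1 + 1 / \<eta>) * t0 powr (- \<eta>)"
    by (simp add: distrib_left distrib_right)
qed

text \<open>Here \<open>P\<close> projects onto the span of the vectors indexed by \<open>J\<close>.
  An upper bound on the rank suffices, since the tail condition asks only that \<open>t\<close>
  exceed a multiple of it.\<close>

lemma orthonormal_projection:
  fixes v :: "'n \<Rightarrow> real ^ 'n"
  assumes v: "orthonormal v" and P: "P = (\<Sum>i\<in>J. outer_square (v i))"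
  shows "orthogonal_projection P" "(norm (P *v x))\<^sup>2 = (\<Sum>i\<in>J. (v i \<bullet> x)\<^sup>2)" "rank P \<le> card J"
proof -
  have Px: "P *v x = (\<Sum>i\<in>J. (v i \<bullet> x) *\<^sub>R v i)" for x
    by (simp add: P matrix_vector_mult_sum_left outer_square_mult)
  have vP: "v j \<bullet> (P *v x) = (if j \<in> J then v j \<bullet> x else 0)" for j x
    using v by (simp add: Px inner_sum_right orthonormal_def if_distrib[of "\<lambda>a. _ * a"] cong: if_cong)
  have "P *v (P *v x) = P *v x" for x
    by (simp only: Px[of "P *v x"] vP) (simp add: Px)
  then have "P ** P = P" by (simp add: matrix_eq matrix_vector_mul_assoc[symmetric])
  moreover have "transpose P = P" by (simp add: P transpose_sum transpose_outer_square)
  ultimately show "orthogonal_projection P" by (simp add: orthogonal_projection_def)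
  have "(norm (P *v x))\<^sup>2 = (P *v x) \<bullet> (P *v x)" by (simp add: power2_norm_eq_inner)
  also have "\<dots> = (\<Sum>i\<in>J. (v i \<bullet> x) * (v i \<bullet> (P *v x)))" by (subst Px) (simp add: inner_sum_left)
  also have "\<dots> = (\<Sum>i\<in>J. (v i \<bullet> x)\<^sup>2)" by (simp add: vP power2_eq_square)
  finally show "(norm (P *v x))\<^sup>2 = (\<Sum>i\<in>J. (v i \<bullet> x)\<^sup>2)" .
  have "range ((*v) P) \<subseteq> span (v ` J)"
    unfolding Px by (intro image_subsetI span_sum span_scale span_base imageI)
  then have "dim (range ((*v) P)) \<le> card (v ` J)" by (intro dim_le_card) auto
  then show "rank P \<le> card J"
    using card_image_le[of J v] by (simp add: rank_dim_range)
qed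

text \<open>A barrier step involves one random vector and a fixed matrix; independence enters only
  when the steps are chained.\<close>

locale regular_isotropic_vector = prob_space +
  fixes X :: "'a \<Rightarrow> real ^ 'n" and C \<eta> :: real
  assumes X[measurable]: "X \<in> borel_measurable M" and isotropic: "isotropic M X"
    and C: "0 < C" and \<eta>: "0 < \<eta>"
    and projection_tail: "\<And>P t. orthogonal_projection P \<Longrightarrow> C * real (rank P) < t \<Longrightarrow>
      prob {\<omega> \<in> space M. t < (norm (P *v X \<omega>))\<^sup>2} \<le> C * t powr (- 1 - \<eta>)"
begin

lemma coordinate_square:
  "integrable M (\<lambda>\<omega>. (w \<bullet> X \<omega>)\<^sup>2)" "expectation (\<lambda>\<omega>. (w \<bullet> X \<omega>)\<^sup>2) = w \<bullet> w"
proof -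
  have "linear (\<lambda>A :: real ^ 'n ^ 'n. w \<bullet> (A *v w))"
    by (rule linearI) (simp_all add: matrix_vector_mult_add_rdistrib inner_add_right
        matrix_vector_mult_scaleR_left)
  then have bl: "bounded_linear (\<lambda>A :: real ^ 'n ^ 'n. w \<bullet> (A *v w))"
    by (simp add: linear_conv_bounded_linear)
  have eq: "w \<bullet> (outer_square (X \<omega>) *v w) = (w \<bullet> X \<omega>)\<^sup>2" for \<omega>
    by (simp add: outer_square_mult power2_eq_square inner_commute)
  have int: "integrable M (\<lambda>\<omega>. outer_square (X \<omega>))" and I: "(LINT \<omega>|M. outer_square (X \<omega>)) = mat 1"
    using isotropic by (auto simp: isotropic_def)
  show "integrable M (\<lambda>\<omega>. (w \<bullet> X \<omega>)\<^sup>2)" using integrable_bounded_linear[OF bl int] by (simp add: eq)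
  show "expectation (\<lambda>\<omega>. (w \<bullet> X \<omega>)\<^sup>2) = w \<bullet> w"
    using integral_bounded_linear[OF bl int] by (simp add: eq I)
qed

lemma coordinate_sum_tail:
  assumes v: "orthonormal v" and t: "C * real (card J) < t"
  shows "prob {\<omega> \<in> space M. t < (\<Sum>i\<in>J. (v i \<bullet> X \<omega>)\<^sup>2)} \<le> C * t powr (- 1 - \<eta>)"
proof -
  let ?P = "\<Sum>i\<in>J. outer_square (v i)"
  have "C * real (rank ?P) \<le> C * real (card J)"
    using orthonormal_projection(3)[OF v refl, of J] C by (intro mult_left_mono) auto
  with t have "C * real (rank ?P) < t" by linarith
  from projection_tail[OF orthonormal_projection(1)[OF v refl] this]
  show ?thesis by (simp only: orthonormal_projection(2)[OF v refl])
qed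

text \<open>Isotropy keeps the tail constant away from zero: a coordinate has second moment one.\<close>

lemma tail_constant_ge: "2 \<le> C * (6 + 6 / \<eta>)"
proof (cases "C < \<eta> / (1 + \<eta>)")
  case False
  then have "\<eta> / (1 + \<eta>) * (6 + 6 / \<eta>) \<le> C * (6 + 6 / \<eta>)"
    using \<eta> by (intro mult_right_mono) auto
  moreover have "6 + 6 / \<eta> = 6 * ((1 + \<eta>) / \<eta>)" using \<eta> by (simp add: field_simps)
  then have "\<eta> / (1 + \<eta>) * (6 + 6 / \<eta>) = 6" using \<eta> by (simp del: distrib_left_numeral)
  ultimately show ?thesis by linarith
next
  case True
  \<comment> \<open>In this case \<open>t0\<close> exceeds \<open>C\<close>, so the tail condition
    for rank one holds from \<open>t0\<close> on. Moreover \<open>1 - t0 = 1 / (1 + \<eta>)\<close>,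
    and \<open>t0 powr (- \<eta>)\<close> is the quantity bounded by 3.\<close>
  define t0 where "t0 = \<eta> / (1 + \<eta>)"
  have t0: "0 < t0" using \<eta> by (simp add: t0_def)
  define v where "v = (\<lambda>i :: 'n. axis i 1 :: real ^ 'n)"
  have v: "orthonormal v" by (auto simp: v_def orthonormal_def inner_axis_axis)
  define Z where "Z \<omega> = (v undefined \<bullet> X \<omega>)\<^sup>2" for \<omega>
  have Z: "integrable M Z" "expectation Z = 1"
    using coordinate_square[of "v undefined"] v by (simp_all add: Z_def[abs_def] orthonormal_def)
  have tail: "prob {\<omega> \<in> space M. t < Z \<omega>} \<le> C * t powr (- 1 - \<eta>)" if "t0 \<le> t" for t
    using coordinate_sum_tail[OF v, of "{undefined}" t] True that by (simp add: t0_def Z_def)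
  have "1 \<le> expectation (\<lambda>\<omega>. t0 + max (Z \<omega> - t0) 0)"
    unfolding Z(2)[symmetric] using Z(1) by (intro integral_mono) auto
  also have "\<dots> = t0 + expectation (\<lambda>\<omega>. max (Z \<omega> - t0) 0)"
    using Z(1) by (subst Bochner_Integration.integral_add) (auto simp: prob_space)
  also have "\<dots> \<le> t0 + C / \<eta> * t0 powr (- \<eta>)"
    using expectation_tail_excess[OF Z(1) C \<eta> t0 tail] by simp
  finally have "1 - t0 \<le> C / \<eta> * t0 powr (- \<eta>)" by simp
  moreover have "t0 powr (- \<eta>) \<le> 3"
  proof -
    have "1 + 1 / \<eta> = 1 / t0" using \<eta> by (simp add: t0_def field_simps)
    then have "(1 + 1 / \<eta>) powr \<eta> = t0 powr (- \<eta>)" using t0 by (simp add: powr_divide powr_minus_divide)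
    then show ?thesis using one_plus_inverse_powr_le[OF \<eta>] by simp
  qed
  then have "C / \<eta> * t0 powr (- \<eta>) \<le> C / \<eta> * 3" using C \<eta> by (intro mult_left_mono) auto
  ultimately have "1 - t0 \<le> C / \<eta> * 3" by linarith
  moreover have "1 - t0 = 1 / (1 + \<eta>)" using \<eta> by (simp add: t0_def field_simps)
  ultimately have "1 / (1 + \<eta>) \<le> C / \<eta> * 3" by simp
  then have "1 / (1 + \<eta>) * (2 * (1 + \<eta>)) \<le> C / \<eta> * 3 * (2 * (1 + \<eta>))"
    using \<eta> by (intro mult_right_mono) auto
  moreover have "C / \<eta> * 3 * (2 * (1 + \<eta>)) = C * (6 + 6 / \<eta>)" using \<eta> by (simp add: field_simps)
  moreover have "1 / (1 + \<eta>) * (2 * (1 + \<eta>)) = 2" using \<eta> by (simp del: distrib_left_numeral)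
  ultimately show ?thesis by linarith
qed

text \<open>The hypothesis \<open>large\<close> puts every cut-off
  \<open>t k * block_scale \<mu> k\<close> beyond \<open>C\<close> times the size of the block,
  where the tail condition for its projection applies. Each block then contributes a truncated first
  moment divided by \<open>t k\<close>.\<close>

lemma excess_expectation:
  assumes v: "orthonormal v" and t: "\<And>k. 0 < t k" and \<mu>: "\<And>i. 0 < \<mu> i"
    and large: "\<And>k. C * real (card {i. block \<mu> i = k}) < t k * block_scale \<mu> k"
  shows "integrable M (\<lambda>\<omega>. excess \<mu> t (\<lambda>i. (v i \<bullet> X \<omega>)\<^sup>2))"
    "expectation (\<lambda>\<omega>. excess \<mu> t (\<lambda>i. (v i \<bullet> X \<omega>)\<^sup>2))
      \<le> C * (1 + 1 / \<eta>) * (\<Sum>k\<in>range (block \<mu>). t k powr (- 1 - \<eta>) * block_scale \<mu> k powr (- \<eta>))"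
proof -
  define Z where "Z k \<omega> = block_sum \<mu> (\<lambda>i. (v i \<bullet> X \<omega>)\<^sup>2) k" for k \<omega>
  have b0: "0 < block_scale \<mu> k" for k
    using block_scale_bounds(1,2)[where \<mu> = \<mu>, OF \<mu>] by (rule less_le_trans)
  have intZ: "integrable M (Z k)" for k
    unfolding Z_def[abs_def] block_sum_def by (intro Bochner_Integration.integrable_sum coordinate_square)
  have t0: "0 < t k * block_scale \<mu> k" for k using t b0 by simp
  have tail: "prob {\<omega> \<in> space M. r < Z k \<omega>} \<le> C * r powr (- 1 - \<eta>)"
    if "t k * block_scale \<mu> k \<le> r" for k r
    unfolding Z_def block_sum_def using large[of k] that by (intro coordinate_sum_tail[OF v]) auto
  note part = expectation_tail_part[OF intZ C \<eta> t0 tail]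
  have ex: "excess \<mu> t (\<lambda>i. (v i \<bullet> X \<omega>)\<^sup>2)
      = (\<Sum>k\<in>range (block \<mu>). 1 / t k * (if t k * block_scale \<mu> k < Z k \<omega> then Z k \<omega> else 0))" for \<omega>
    unfolding excess_def Z_def by (intro sum.cong) auto
  show "integrable M (\<lambda>\<omega>. excess \<mu> t (\<lambda>i. (v i \<bullet> X \<omega>)\<^sup>2))"
    unfolding ex by (intro Bochner_Integration.integrable_sum integrable_mult_right part(1))
  have "expectation (\<lambda>\<omega>. excess \<mu> t (\<lambda>i. (v i \<bullet> X \<omega>)\<^sup>2))
      = (\<Sum>k\<in>range (block \<mu>). 1 / t k * expectation (\<lambda>\<omega>. if t k * block_scale \<mu> k < Z k \<omega> then Z k \<omega> else 0))"
    unfolding ex using part(1)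
    by (subst Bochner_Integration.integral_sum) (auto intro!: integrable_divide_zero)
  also have "\<dots> \<le> (\<Sum>k\<in>range (block \<mu>). 1 / t k * (C * (1 + 1 / \<eta>) * (t k * block_scale \<mu> k) powr (- \<eta>)))"
    using less_imp_le[OF t] by (intro sum_mono mult_left_mono part(2)) auto
  also have "\<dots> = C * (1 + 1 / \<eta>) * (\<Sum>k\<in>range (block \<mu>). t k powr (- 1 - \<eta>) * block_scale \<mu> k powr (- \<eta>))"
    unfolding sum_distrib_left
  proof (intro sum.cong refl)
    fix k
    have "t k powr (- 1 - \<eta>) = t k powr (- \<eta>) / t k"
      using t[of k] powr_diff[of "t k" "- \<eta>" 1] by (simp add: minus_diff_commute[of \<eta> 1])
    then show "1 / t k * (C * (1 + 1 / \<eta>) * (t k * block_scale \<mu> k) powr (- \<eta>))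
        = C * (1 + 1 / \<eta>) * (t k powr (- 1 - \<eta>) * block_scale \<mu> k powr (- \<eta>))"
      by (simp only: powr_mult) simp
  qed
  finally show "expectation (\<lambda>\<omega>. excess \<mu> t (\<lambda>i. (v i \<bullet> X \<omega>)\<^sup>2))
      \<le> C * (1 + 1 / \<eta>) * (\<Sum>k\<in>range (block \<mu>). t k powr (- 1 - \<eta>) * block_scale \<mu> k powr (- \<eta>))" .
qed

lemma integrable_soft_max_update:
  assumes \<phi>: "0 < \<phi>"
  shows "integrable M (\<lambda>\<omega>. soft_max \<phi> (A + \<sigma> *\<^sub>R outer_square (X \<omega>)))"
proof (rule Bochner_Integration.integrable_bound)
  have int: "integrable M (\<lambda>\<omega>. outer_square (X \<omega>))" using isotropic by (auto simp: isotropic_def)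
  then have [measurable]: "(\<lambda>\<omega>. outer_square (X \<omega>)) \<in> borel_measurable M" by auto
  show "integrable M (\<lambda>\<omega>. \<bar>soft_max \<phi> A\<bar> + \<bar>\<sigma>\<bar> * norm (outer_square (X \<omega>)))"
    using int by (intro Bochner_Integration.integrable_add integrable_mult_right integrable_norm) auto
  have [measurable]: "soft_max \<phi> \<in> borel_measurable borel"
    by (rule borel_measurable_continuous_onI[OF continuous_soft_max[OF \<phi>]])
  show "(\<lambda>\<omega>. soft_max \<phi> (A + \<sigma> *\<^sub>R outer_square (X \<omega>))) \<in> borel_measurable M" by measurable
  show "AE \<omega> in M. norm (soft_max \<phi> (A + \<sigma> *\<^sub>R outer_square (X \<omega>)))
      \<le> norm (\<bar>soft_max \<phi> A\<bar> + \<bar>\<sigma>\<bar> * norm (outer_square (X \<omega>)))"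
  proof (rule AE_I2)
    fix \<omega>
    show "norm (soft_max \<phi> (A + \<sigma> *\<^sub>R outer_square (X \<omega>)))
        \<le> norm (\<bar>soft_max \<phi> A\<bar> + \<bar>\<sigma>\<bar> * norm (outer_square (X \<omega>)))"
      using soft_max_lipschitz[OF \<phi>, of "A + \<sigma> *\<^sub>R outer_square (X \<omega>)" A] by simp
  qed
qed

text \<open>The drift of one step from a fixed matrix. The typical shift \<open>q2\<close> has
  expectation exactly 1; the factor \<open>1 - 2 * s\<close> and the excess together cost at most
  \<epsilon>.\<close>

lemma soft_max_update:
  assumes \<phi>: "\<phi> = \<epsilon> powr (1 + 2 / \<eta>) / (512 * (16 * C) powr (1 + 2 / \<eta>) * (6 + 6 / \<eta>) powr (1 + 4 / \<eta>))"
    and \<epsilon>: "0 < \<epsilon>" "\<epsilon> \<le> 1" and \<sigma>: "\<sigma> = 1 \<or> \<sigma> = - 1"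
  shows "expectation (\<lambda>\<omega>. soft_max \<phi> (A + \<sigma> *\<^sub>R outer_square (X \<omega>))) \<le> soft_max \<phi> A + \<sigma> + \<epsilon>"
proof (rule field_le_epsilon)
  fix e :: real assume "0 < e"
  note budgets = C \<eta> refl tail_constant_ge refl \<epsilon> \<phi>
  have \<phi>0: "0 < \<phi>" by (rule \<phi>_pos[OF budgets])
  \<comment> \<open>The barrier is available only strictly above the soft edge; the slack
    \<open>e\<close> is removed at the end.\<close>
  define u where "u = soft_max \<phi> A + e"
  define M0 where "M0 = mat u - symmetric_part A"
  have "barrier \<phi> M0" unfolding M0_def by (rule barrier_above_soft_max[OF \<phi>0]) (use \<open>0 < e\<close> in \<open>simp add: u_def\<close>)
  then obtain v \<mu> where v: "orthonormal v" and M0: "\<And>i. M0 *v v i = \<mu> i *\<^sub>R v i"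
    and \<mu>: "\<And>i. 0 < \<mu> i" and sum\<mu>: "(\<Sum>i\<in>UNIV. 1 / \<mu> i) \<le> \<phi>"
    using barrier_eigenbasis by blast
  have sym: "transpose M0 = M0" by (simp add: M0_def transpose_diff transpose_symmetric_part)
  define \<theta> where "\<theta> = \<eta> / (2 * (1 + \<eta>))"
  have \<theta>0: "0 < \<theta>" using \<eta> by (simp add: \<theta>_def)
  have \<tau>0: "0 < \<epsilon> / 16" using \<epsilon> by simp
  define t where "t = threshold C \<theta> (\<epsilon> / 16) \<mu>"
  define s where "s = \<epsilon> / 8"
  note t = threshold_pos[where \<mu> = \<mu>, OF \<mu> C \<theta>0 \<tau>0, folded t_def]
  have sum_t: "(\<Sum>k\<in>range (block \<mu>). t k) \<le> s"
    using sum_threshold_le[where \<mu> = \<mu>, OF \<mu> C \<theta>0 \<tau>0 sum\<mu>] threshold_budget[OF budgets]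
    by (simp add: t_def s_def)
  have s: "0 < s" "s < 1 / 2" using \<epsilon> by (auto simp: s_def)
  define a where "a \<omega> i = (v i \<bullet> X \<omega>)\<^sup>2" for \<omega> i
  define T where "T = (\<Sum>i\<in>UNIV. 1 / (\<mu> i)\<^sup>2)"
  define q2 where "q2 \<omega> = (\<Sum>i\<in>UNIV. a \<omega> i / (\<mu> i)\<^sup>2) / T" for \<omega>
  define D where "D \<omega> = excess \<mu> t (a \<omega>)" for \<omega>
  have "\<mu> i \<noteq> 0" for i using \<mu>[of i] by linarith
  then have T0: "0 < T" unfolding T_def by (intro sum_pos) auto
  have inta: "integrable M (\<lambda>\<omega>. a \<omega> i)" for i unfolding a_def by (rule coordinate_square)
  have Ea: "expectation (\<lambda>\<omega>. a \<omega> i) = 1" for i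
    unfolding a_def using coordinate_square(2) v by (simp add: orthonormal_def)
  have intq2: "integrable M q2" unfolding q2_def[abs_def]
    by (intro integrable_divide_zero Bochner_Integration.integrable_sum) (simp add: inta)
  have Eq2: "expectation q2 = 1"
    unfolding q2_def[abs_def] using T0 by (simp add: inta Ea T_def)
  have intD: "integrable M D" unfolding D_def[abs_def] a_def
    by (rule excess_expectation(1)[where \<mu> = \<mu>, OF v t(1) \<mu> t(2)])
  have "expectation D \<le> C * (1 + 1 / \<eta>)
      * (\<Sum>k\<in>range (block \<mu>). t k powr (- 1 - \<eta>) * block_scale \<mu> k powr (- \<eta>))"
    unfolding D_def[abs_def] a_def by (rule excess_expectation(2)[where \<mu> = \<mu>, OF v t(1) \<mu> t(2)])
  also have "\<dots> \<le> C * (1 + 1 / \<eta>) * ((\<epsilon> / 16 * (1 - exp (- \<theta>))) powr (- 1 - \<eta>) * \<phi> powr \<eta>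
      * (1 / (1 - exp (- \<eta> / 2))))"
    using C \<eta> sum_threshold_powr_le[where \<mu> = \<mu>, OF \<mu> C \<eta> \<tau>0 sum\<mu> \<theta>_def]
    by (intro mult_left_mono) (auto simp: t_def)
  also have "\<dots> \<le> \<epsilon> / 2" by (rule excess_budget[OF budgets \<theta>_def])
  finally have ED: "expectation D \<le> \<epsilon> / 2" .
  have a0: "0 \<le> a \<omega> i" for \<omega> i by (simp add: a_def)
  have D0: "0 \<le> D \<omega>" for \<omega> unfolding D_def by (rule excess_nonneg[OF t(1) a0])
  have q20: "0 \<le> q2 \<omega>" for \<omega> unfolding q2_def using T0 a0 by (intro divide_nonneg_nonneg sum_nonneg) auto
  have dich: "(\<Sum>i\<in>UNIV. a \<omega> i / \<mu> i) \<le> s \<or>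
    Min (range \<mu>) \<le> D \<omega> \<and> (\<Sum>i\<in>UNIV. a \<omega> i / (\<mu> i + D \<omega>)) \<le> s \<and> q2 \<omega> \<le> D \<omega>" for \<omega>
    unfolding D_def q2_def T_def using s(2) by (intro excess_dichotomy[OF \<mu> a0 t(1) sum_t]) simp
  have M0_eq: "mat (u + d) - symmetric_part (A + r *\<^sub>R outer_square x) = M0 + mat d - r *\<^sub>R outer_square x"
    for d r x
    by (simp add: M0_def symmetric_part_add mat_add symmetric_part_eq[of "r *\<^sub>R outer_square x"]
        transpose_scaleR transpose_outer_square)
  have int: "integrable M (\<lambda>\<omega>. soft_max \<phi> (A + \<sigma> *\<^sub>R outer_square (X \<omega>)))"
    by (rule integrable_soft_max_update[OF \<phi>0])
  consider "\<sigma> = 1" | "\<sigma> = - 1" using \<sigma> by blast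
  then show "expectation (\<lambda>\<omega>. soft_max \<phi> (A + \<sigma> *\<^sub>R outer_square (X \<omega>))) \<le> soft_max \<phi> A + \<sigma> + \<epsilon> + e"
  proof cases
    case 1
    \<comment> \<open>Adding the two shifts gives one bound for both alternatives, so no expectation
      has to be split over events.\<close>
    have le: "soft_max \<phi> (A + \<sigma> *\<^sub>R outer_square (X \<omega>)) \<le> u + (q2 \<omega> / (1 - 2 * s) + D \<omega>)" for \<omega>
    proof -
      have r0: "0 \<le> q2 \<omega> / (1 - 2 * s)" using q20 s by simp
      from dich[of \<omega>] consider "(\<Sum>i\<in>UNIV. a \<omega> i / \<mu> i) \<le> s"
        | "Min (range \<mu>) \<le> D \<omega>" "(\<Sum>i\<in>UNIV. a \<omega> i / (\<mu> i + D \<omega>)) \<le> s" by blast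
      then show ?thesis
      proof cases
        case 1
        have "barrier \<phi> (M0 + mat (q2 \<omega> / (1 - 2 * s)) - outer_square (X \<omega>))"
          using 1 s(2) by (intro barrier_shift_up_small[OF sym v M0 \<mu> sum\<mu>]) (auto simp: a_def q2_def T_def)
        then have "soft_max \<phi> (A + 1 *\<^sub>R outer_square (X \<omega>)) \<le> u + q2 \<omega> / (1 - 2 * s)"
          by (intro soft_max_le[OF \<phi>0]) (simp add: M0_eq[of _ 1, simplified])
        then show ?thesis using D0[of \<omega>] \<open>\<sigma> = 1\<close> by simp
      next
        case 2
        have "barrier \<phi> (M0 + mat (D \<omega>) - outer_square (X \<omega>))"
          using 2 s(2) by (intro barrier_shift_up_large[OF sym v M0 \<mu> sum\<mu>]) (auto simp: a_def)
        then have "soft_max \<phi> (A + 1 *\<^sub>R outer_square (X \<omega>)) \<le> u + D \<omega>"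
          by (intro soft_max_le[OF \<phi>0]) (simp add: M0_eq[of _ 1, simplified])
        then show ?thesis using r0 \<open>\<sigma> = 1\<close> by simp
      qed
    qed
    have "expectation (\<lambda>\<omega>. soft_max \<phi> (A + \<sigma> *\<^sub>R outer_square (X \<omega>)))
        \<le> expectation (\<lambda>\<omega>. u + (q2 \<omega> / (1 - 2 * s) + D \<omega>))"
      using int intq2 intD by (intro integral_mono le) auto
    also have "\<dots> = u + (1 / (1 - 2 * s) + expectation D)"
      using intq2 intD by (simp add: Eq2 prob_space)
    also have "1 / (1 - 2 * s) \<le> 1 + \<epsilon> / 2"
    proof -
      have "\<epsilon> * \<epsilon> \<le> 2 * \<epsilon>" using \<epsilon> by (intro mult_right_mono) auto
      then have "1 \<le> (1 + \<epsilon> / 2) * (1 - 2 * s)" by (simp add: s_def algebra_simps)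
      then show ?thesis using s(2) by (simp add: pos_divide_le_eq)
    qed
    finally show ?thesis using ED 1 by (simp add: u_def)
  next
    case 2
    \<comment> \<open>When the resolvent form is not small, the soft edge merely does not rise. The
      bound survives because \<open>q2 \<omega> \<le> D \<omega>\<close> makes the claimed decrease
      nonpositive.\<close>
    have le: "soft_max \<phi> (A + \<sigma> *\<^sub>R outer_square (X \<omega>)) \<le> u - (1 - 2 * s) * (q2 \<omega> - D \<omega>)" for \<omega>
    proof -
      have r0: "0 \<le> (1 - 2 * s) * D \<omega>" using D0 s by simp
      from dich[of \<omega>] consider "(\<Sum>i\<in>UNIV. a \<omega> i / \<mu> i) \<le> s" | "q2 \<omega> \<le> D \<omega>" by blast
      then show ?thesis
      proof cases
        case 1
        have "barrier \<phi> (M0 + mat (- ((1 - 2 * s) * q2 \<omega>)) + outer_square (X \<omega>))"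
          using 1 s(2) by (intro barrier_shift_down[OF sym v M0 \<mu> sum\<mu>]) (auto simp: a_def q2_def T_def)
        then have "soft_max \<phi> (A + (- 1) *\<^sub>R outer_square (X \<omega>)) \<le> u + - ((1 - 2 * s) * q2 \<omega>)"
          by (intro soft_max_le[OF \<phi>0]) (simp only: M0_eq, simp)
        then show ?thesis using r0 \<open>\<sigma> = - 1\<close> by (simp add: right_diff_distrib)
      next
        case 2
        have "soft_max \<phi> (A + (- 1) *\<^sub>R outer_square (X \<omega>)) \<le> soft_max \<phi> A + 0"
          by (intro soft_max_le_add[OF \<phi>0])
            (simp add: matrix_vector_mult_diff_rdistrib inner_diff_right outer_square_mult inner_commute)
        moreover have "(1 - 2 * s) * (q2 \<omega> - D \<omega>) \<le> 0"
          using 2 s(2) by (intro mult_nonneg_nonpos) auto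
        ultimately show ?thesis using \<open>0 < e\<close> \<open>\<sigma> = - 1\<close> by (simp add: u_def)
      qed
    qed
    have "expectation (\<lambda>\<omega>. soft_max \<phi> (A + \<sigma> *\<^sub>R outer_square (X \<omega>)))
        \<le> expectation (\<lambda>\<omega>. u - (1 - 2 * s) * (q2 \<omega> - D \<omega>))"
      using int intq2 intD by (intro integral_mono le) auto
    also have "\<dots> = u - (1 - 2 * s) * (1 - expectation D)"
      using intq2 intD by (simp add: Eq2 prob_space)
    also have "\<dots> \<le> u - (1 - 2 * s) * (1 - \<epsilon> / 2)"
      using ED s by (intro diff_left_mono mult_left_mono) auto
    also have "\<dots> \<le> u - 1 + \<epsilon>"
    proof -
      have "0 \<le> \<epsilon> * \<epsilon>" by simp
      then show ?thesis using \<epsilon> by (simp add: s_def algebra_simps)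
    qed
    finally show ?thesis using 2 by (simp add: u_def)
  qed
qed

end

subsection \<open>Independent summation\<close>

lemma continuous_outer_square: "continuous_on UNIV (outer_square :: real ^ 'n \<Rightarrow> _)"
  unfolding outer_square_def[abs_def] by (intro continuous_intros)

lemma borel_measurable_outer_square [measurable]:
  "(outer_square :: real ^ 'n \<Rightarrow> _) \<in> borel_measurable borel"
  by (rule borel_measurable_continuous_onI[OF continuous_outer_square])

text \<open>By independence the joint law is a product, so Fubini integrates the bound for a fixed
  \<open>y\<close> over the law of \<open>Y\<close>.\<close>

lemma (in prob_space) expectation_indep_update_le:
  fixes f :: "'b::second_countable_topology \<Rightarrow> 'b \<Rightarrow> real"
  assumes ind: "indep_var borel Y borel Z"
    and f: "(\<lambda>(y, z). f y z) \<in> borel_measurable (borel \<Otimes>\<^sub>M borel)"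
    and g: "g \<in> borel_measurable borel"
    and int_f: "integrable M (\<lambda>\<omega>. f (Y \<omega>) (Z \<omega>))" and int_g: "integrable M (\<lambda>\<omega>. g (Y \<omega>))"
    and le: "\<And>y. expectation (\<lambda>\<omega>. f y (Z \<omega>)) \<le> g y"
  shows "expectation (\<lambda>\<omega>. f (Y \<omega>) (Z \<omega>)) \<le> expectation (\<lambda>\<omega>. g (Y \<omega>))"
proof -
  note [measurable] = f g
  have [measurable]: "Y \<in> borel_measurable M" "Z \<in> borel_measurable M"
    and eq: "distr M borel Y \<Otimes>\<^sub>M distr M borel Z = distr M (borel \<Otimes>\<^sub>M borel) (\<lambda>\<omega>. (Y \<omega>, Z \<omega>))"
    using ind by (auto simp: indep_var_distribution_eq)
  let ?Y = "distr M borel Y" and ?Z = "distr M borel Z"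
  interpret PY: prob_space ?Y by (rule prob_space_distr) measurable
  interpret PZ: prob_space ?Z by (rule prob_space_distr) measurable
  interpret P: pair_sigma_finite ?Y ?Z ..
  let ?f = "\<lambda>(y, z). f y z"
  have int: "integrable (?Y \<Otimes>\<^sub>M ?Z) ?f"
    unfolding eq using int_f by (subst integrable_distr_eq) auto
  have "expectation (\<lambda>\<omega>. f (Y \<omega>) (Z \<omega>)) = integral\<^sup>L (?Y \<Otimes>\<^sub>M ?Z) ?f"
    unfolding eq by (subst integral_distr) auto
  also have "\<dots> = (LINT y|?Y. (LINT z|?Z. f y z))"
    using P.integral_fst'[OF int] by simp
  also have "\<dots> \<le> (LINT y|?Y. g y)"
  proof (rule integral_mono)
    show "integrable ?Y (\<lambda>y. LINT z|?Z. f y z)" using P.integrable_fst'[OF int] by simp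
    show "integrable ?Y g" using int_g by (subst integrable_distr_eq) auto
    fix y
    have "(LINT z|?Z. f y z) = expectation (\<lambda>\<omega>. f y (Z \<omega>))" by (rule integral_distr) measurable
    then show "(LINT z|?Z. f y z) \<le> g y" using le by simp
  qed
  also have "\<dots> = expectation (\<lambda>\<omega>. g (Y \<omega>))" by (rule integral_distr) measurable
  finally show ?thesis .
qed

lemma (in prob_space) indep_var_partial_sum:
  fixes f :: "'c::topological_space \<Rightarrow> 'd::{second_countable_topology, topological_comm_monoid_add}"
  assumes ind: "indep_vars (\<lambda>_. borel) X {1..N}" and k: "Suc k \<le> N"
    and f: "f \<in> borel_measurable borel"
  shows "indep_var borel (\<lambda>\<omega>. \<Sum>i = 1..k. f (X i \<omega>)) borel (\<lambda>\<omega>. f (X (Suc k) \<omega>))"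
proof -
  note [measurable] = f
  have "indep_var borel ((\<lambda>g. \<Sum>i = 1..k. f (g i)) \<circ> (\<lambda>\<omega>. restrict (\<lambda>i. X i \<omega>) {1..k}))
      borel ((\<lambda>g. f (g (Suc k))) \<circ> (\<lambda>\<omega>. restrict (\<lambda>i. X i \<omega>) {Suc k}))"
    using k by (intro indep_var_compose[OF indep_var_restrict[OF ind]]) auto
  also have "(\<lambda>g. \<Sum>i = 1..k. f (g i)) \<circ> (\<lambda>\<omega>. restrict (\<lambda>i. X i \<omega>) {1..k}) = (\<lambda>\<omega>. \<Sum>i = 1..k. f (X i \<omega>))"
    by (auto intro!: sum.cong)
  also have "(\<lambda>g. f (g (Suc k))) \<circ> (\<lambda>\<omega>. restrict (\<lambda>i. X i \<omega>) {Suc k}) = (\<lambda>\<omega>. f (X (Suc k) \<omega>))" by auto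
  finally show ?thesis .
qed

text \<open>The two error terms balance at \<open>\<epsilon> = (K * y) powr c\<close>, since
  \<open>c * (1 + 2 / \<eta>) = 1 - c\<close>. This is an admissible \<epsilon> only for
  \<open>K * y \<le> 1\<close>; in the other case the target error \<open>K * y powr c\<close> is at
  least 1.\<close>

lemma optimize_scale:
  fixes K y \<eta> :: real
  assumes K: "4 \<le> K" and y: "0 < y" and \<eta>: "0 < \<eta>" and c: "c = \<eta> / (2 * \<eta> + 2)"
  obtains "1 \<le> K * y powr c" "1 < K * y"
  | \<epsilon> where "0 < \<epsilon>" "\<epsilon> \<le> 1" "\<epsilon> + y / (\<epsilon> powr (1 + 2 / \<eta>) / K) \<le> K * y powr c"
proof (cases "1 < K * y")
  case True
  have c01: "0 < c" "c \<le> 1" using \<eta> by (auto simp: c)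
  have "1 \<le> (K * y) powr c" using True c01 by (intro ge_one_powr_ge_zero) auto
  also have "\<dots> = K powr c * y powr c" using K y by (simp add: powr_mult)
  also have "\<dots> \<le> K powr 1 * y powr c" using K c01 by (intro mult_right_mono powr_mono) auto
  finally show thesis using that(1) True K by simp
next
  case False
  define \<epsilon> where "\<epsilon> = (K * y) powr c"
  have Ky: "0 < K * y" "K * y \<le> 1" using False K y by auto
  have c01: "0 < c" "c \<le> 1 / 2" using \<eta> by (auto simp: c field_simps)
  have \<epsilon>: "0 < \<epsilon>" "\<epsilon> \<le> 1" unfolding \<epsilon>_def using Ky c01 by (auto intro: powr_le1)
  have e: "1 - c * (1 + 2 / \<eta>) = c"
  proof -
    have "c * (1 + 2 / \<eta>) + c = c * ((2 * \<eta> + 2) / \<eta>)" using \<eta> by (simp add: field_simps)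
    also have "\<dots> = 1" using \<eta> by (simp add: c)
    finally show ?thesis by simp
  qed
  have "y / (\<epsilon> powr (1 + 2 / \<eta>) / K) = (K * y) powr 1 / (K * y) powr (c * (1 + 2 / \<eta>))"
    using Ky by (simp add: \<epsilon>_def powr_powr)
  also have "\<dots> = (K * y) powr (1 - c * (1 + 2 / \<eta>))" by (rule powr_diff[symmetric])
  also have "\<dots> = \<epsilon>" by (simp only: e \<epsilon>_def)
  finally have "\<epsilon> + y / (\<epsilon> powr (1 + 2 / \<eta>) / K) = 2 * K powr c * y powr c"
    using K y by (simp add: \<epsilon>_def powr_mult)
  also have "\<dots> \<le> K * y powr c"
  proof (intro mult_right_mono)
    \<comment> \<open>Both \<open>c \<le> 1 / 2\<close> and \<open>4 \<le> K\<close> enter here, to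
      absorb the factor 2 of the two equal error terms.\<close>
    have "K powr c \<le> K powr (1 / 2)" using K c01 by (intro powr_mono) auto
    also have "\<dots> = sqrt K" using K by (simp add: powr_half_sqrt)
    finally have "2 * K powr c \<le> sqrt K * sqrt K"
      using K real_le_rsqrt[of 2 K] by (intro mult_mono) auto
    then show "2 * K powr c \<le> K" using K by simp
  qed simp
  finally show thesis using that(2) \<epsilon> by blast
qed

theorem corollary1p4:
  fixes M :: "'a measure"
    and X :: "nat \<Rightarrow> 'a \<Rightarrow> real ^ 'n"
    and N :: nat
    and C \<eta> y c C\<^sub>1 :: real
  assumes "prob_space M"
    and "N > 0" and "C > 0" and "\<eta> > 0"
    and "prob_space.indep_vars M (\<lambda>_. borel) X {1..N}"
    and "\<And>i. i \<in> {1..N} \<Longrightarrow> isotropic M (X i)"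
    and "\<And>i P t. i \<in> {1..N} \<Longrightarrow> orthogonal_projection P \<Longrightarrow> t > C * real (rank P) \<Longrightarrow>
           measure M {\<omega> \<in> space M. (norm (P *v X i \<omega>))\<^sup>2 > t} \<le> C * t powr (- 1 - \<eta>)"
    and "y = real CARD('n) / real N"
    and "c = \<eta> / (2 * \<eta> + 2)"
    and "C\<^sub>1 = 512 * (16 * C) powr (1 + 2 / \<eta>) * (6 + 6 / \<eta>) powr (1 + 4 / \<eta>)"
  shows "integrable M (\<lambda>\<omega>. lambda_min (sample_covariance N X \<omega>)) \<and>
    integrable M (\<lambda>\<omega>. lambda_max (sample_covariance N X \<omega>)) \<and>
    1 - C\<^sub>1 * y powr c \<le> (LINT \<omega>|M. lambda_min (sample_covariance N X \<omega>)) \<and>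
    (LINT \<omega>|M. lambda_min (sample_covariance N X \<omega>))
      \<le> (LINT \<omega>|M. lambda_max (sample_covariance N X \<omega>)) \<and>
    (LINT \<omega>|M. lambda_max (sample_covariance N X \<omega>)) \<le> 1 + C\<^sub>1 * (y + y powr c)"
proof -
  interpret prob_space M by (rule assms(1))
  note ind = assms(5) and y = assms(8) and c = assms(9)
  have X[measurable]: "X i \<in> borel_measurable M" if "i \<in> {1..N}" for i
    using ind that by (auto simp: indep_vars_def)
  have regular: "regular_isotropic_vector M (X i) C \<eta>" if "i \<in> {1..N}" for i
    using assms(3,4,6,7) X that by unfold_locales auto
  have N0: "0 < real N" using assms(2) by simp
  have "1 \<in> {1..N}" using assms(2) by simp
  then have CG: "2 \<le> C * (6 + 6 / \<eta>)" using regular_isotropic_vector.tail_constant_ge[OF regular] by blast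
  \<comment> \<open>The constant does not depend on \<epsilon>; the value 1 is inserted only to
    enter the context of constants.\<close>
  have K: "4 \<le> C\<^sub>1"
    using K_ge(1)[OF assms(3,4) refl CG assms(10) zero_less_one order_refl refl] by simp
  define S where "S k \<omega> = (\<Sum>i = 1..k. outer_square (X i \<omega>))" for k \<omega>
  have intS: "integrable M (S k)" if "k \<le> N" for k
    unfolding S_def[abs_def] using assms(6) that
    by (intro Bochner_Integration.integrable_sum) (auto simp: isotropic_def)
  have cov: "sample_covariance N X \<omega> = (1 / real N) *\<^sub>R S N \<omega>" for \<omega>
    by (simp add: sample_covariance_def S_def)
  have symS: "transpose (S k \<omega>) = S k \<omega>" for k \<omega>
    by (simp add: S_def transpose_sum transpose_outer_square)
  have int_lipschitz: "integrable M (\<lambda>\<omega>. h (r *\<^sub>R S k \<omega>))"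
    if "k \<le> N" and h: "continuous_on UNIV h" "\<And>A B. \<bar>h A - h B\<bar> \<le> norm (A - B)"
    for h :: "real ^ 'n ^ 'n \<Rightarrow> real" and k r
  proof (rule Bochner_Integration.integrable_bound)
    have [measurable]: "h \<in> borel_measurable borel" by (rule borel_measurable_continuous_onI[OF h(1)])
    have [measurable]: "S k \<in> borel_measurable M" using intS[OF \<open>k \<le> N\<close>] by auto
    show "(\<lambda>\<omega>. h (r *\<^sub>R S k \<omega>)) \<in> borel_measurable M" by measurable
    show "integrable M (\<lambda>\<omega>. \<bar>h 0\<bar> + \<bar>r\<bar> * norm (S k \<omega>))"
      using intS[OF \<open>k \<le> N\<close>] by (intro Bochner_Integration.integrable_add integrable_mult_right) auto
    show "AE \<omega> in M. norm (h (r *\<^sub>R S k \<omega>)) \<le> norm (\<bar>h 0\<bar> + \<bar>r\<bar> * norm (S k \<omega>))"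
    proof (rule AE_I2)
      fix \<omega>
      show "norm (h (r *\<^sub>R S k \<omega>)) \<le> norm (\<bar>h 0\<bar> + \<bar>r\<bar> * norm (S k \<omega>))"
        using h(2)[of "r *\<^sub>R S k \<omega>" 0] by simp
    qed
  qed
  have lmax: "lambda_max (sample_covariance N X \<omega>) = rayleigh_sup ((1 / real N) *\<^sub>R S N \<omega>)" for \<omega>
    unfolding cov by (rule lambda_max_eq_rayleigh_sup) (simp add: transpose_scaleR symS)
  have lmin: "lambda_min (sample_covariance N X \<omega>) = - rayleigh_sup ((- 1 / real N) *\<^sub>R S N \<omega>)" for \<omega>
    unfolding cov by (subst lambda_min_eq_rayleigh_sup) (simp_all add: transpose_scaleR symS)
  have int_max: "integrable M (\<lambda>\<omega>. lambda_max (sample_covariance N X \<omega>))"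
    unfolding lmax by (intro int_lipschitz continuous_rayleigh_sup rayleigh_sup_lipschitz) simp
  have int_min: "integrable M (\<lambda>\<omega>. lambda_min (sample_covariance N X \<omega>))"
    unfolding lmin
    by (intro Bochner_Integration.integrable_minus int_lipschitz continuous_rayleigh_sup rayleigh_sup_lipschitz) simp
  \<comment> \<open>One estimate for both ends of the spectrum: \<sigma> equal to 1 gives the
    largest eigenvalue, and - 1 gives minus the smallest.\<close>
  have scaled: "expectation (\<lambda>\<omega>. rayleigh_sup ((\<sigma> / real N) *\<^sub>R S N \<omega>)) \<le> \<sigma> + (\<epsilon> + y / (\<epsilon> powr (1 + 2 / \<eta>) / C\<^sub>1))"
    if \<epsilon>: "0 < \<epsilon>" "\<epsilon> \<le> 1" and \<sigma>: "\<sigma> = 1 \<or> \<sigma> = - 1" for \<epsilon> \<sigma>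
  proof -
    define \<phi> where "\<phi> = \<epsilon> powr (1 + 2 / \<eta>) / C\<^sub>1"
    have \<phi>0: "0 < \<phi>" using \<epsilon> K by (simp add: \<phi>_def)
    note lip = continuous_soft_max[OF \<phi>0] soft_max_lipschitz[OF \<phi>0]
    have [measurable]: "soft_max \<phi> \<in> borel_measurable borel"
      by (rule borel_measurable_continuous_onI[OF lip(1)])
    have iter: "expectation (\<lambda>\<omega>. soft_max \<phi> (\<sigma> *\<^sub>R S k \<omega>)) \<le> real CARD('n) / \<phi> + real k * (\<sigma> + \<epsilon>)"
      if "k \<le> N" for k
      using that
    proof (induction k)
      case 0
      then show ?case using soft_max_zero_le[OF \<phi>0, where 'n = 'n] by (simp add: S_def prob_space)
    next
      case (Suc k)
      have S: "\<sigma> *\<^sub>R S (Suc k) \<omega> = \<sigma> *\<^sub>R S k \<omega> + \<sigma> *\<^sub>R outer_square (X (Suc k) \<omega>)" for \<omega>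
        by (simp add: S_def scaleR_right_distrib)
      interpret V: regular_isotropic_vector M "X (Suc k)" C \<eta> by (rule regular) (use Suc.prems in simp)
      have "expectation (\<lambda>\<omega>. soft_max \<phi> (\<sigma> *\<^sub>R S k \<omega> + \<sigma> *\<^sub>R outer_square (X (Suc k) \<omega>)))
          \<le> expectation (\<lambda>\<omega>. soft_max \<phi> (\<sigma> *\<^sub>R S k \<omega>) + \<sigma> + \<epsilon>)"
      proof (rule expectation_indep_update_le[where Y = "S k"
            and f = "\<lambda>A B. soft_max \<phi> (\<sigma> *\<^sub>R A + \<sigma> *\<^sub>R B)"])
        show "indep_var borel (S k) borel (\<lambda>\<omega>. outer_square (X (Suc k) \<omega>))"
          unfolding S_def[abs_def] using Suc.prems by (intro indep_var_partial_sum[OF ind]) auto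
        show "integrable M (\<lambda>\<omega>. soft_max \<phi> (\<sigma> *\<^sub>R S k \<omega> + \<sigma> *\<^sub>R outer_square (X (Suc k) \<omega>)))"
          unfolding S[symmetric] by (rule int_lipschitz[OF Suc.prems lip])
        show "integrable M (\<lambda>\<omega>. soft_max \<phi> (\<sigma> *\<^sub>R S k \<omega>) + \<sigma> + \<epsilon>)"
          using Suc.prems by (intro Bochner_Integration.integrable_add int_lipschitz lip) auto
        show "expectation (\<lambda>\<omega>. soft_max \<phi> (\<sigma> *\<^sub>R A + \<sigma> *\<^sub>R outer_square (X (Suc k) \<omega>)))
            \<le> soft_max \<phi> (\<sigma> *\<^sub>R A) + \<sigma> + \<epsilon>" for A
          by (rule V.soft_max_update[OF _ \<epsilon> \<sigma>]) (simp add: \<phi>_def assms(10))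
      qed measurable
      also have "\<dots> = expectation (\<lambda>\<omega>. soft_max \<phi> (\<sigma> *\<^sub>R S k \<omega>)) + \<sigma> + \<epsilon>"
        using int_lipschitz[OF _ lip, of k \<sigma>] Suc.prems by (simp add: prob_space)
      also have "\<dots> \<le> real CARD('n) / \<phi> + real (Suc k) * (\<sigma> + \<epsilon>)"
        using Suc by (simp add: algebra_simps)
      finally show ?case by (simp only: S)
    qed
    have "rayleigh_sup ((\<sigma> / real N) *\<^sub>R S N \<omega>) \<le> soft_max \<phi> (\<sigma> *\<^sub>R S N \<omega>) / real N" for \<omega>
      unfolding rayleigh_sup_def
    proof (rule cSUP_least)
      show "sphere 0 1 \<noteq> ({} :: (real ^ 'n) set)" by simp
      fix x :: "real ^ 'n" assume "x \<in> sphere 0 1"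
      then have "x \<bullet> ((\<sigma> *\<^sub>R S N \<omega>) *v x) \<le> soft_max \<phi> (\<sigma> *\<^sub>R S N \<omega>)"
        using quadratic_form_le_soft_max[OF \<phi>0, of x "\<sigma> *\<^sub>R S N \<omega>"] by (simp add: norm_eq_1)
      then show "x \<bullet> (((\<sigma> / real N) *\<^sub>R S N \<omega>) *v x) \<le> soft_max \<phi> (\<sigma> *\<^sub>R S N \<omega>) / real N"
        using N0 by (simp add: matrix_vector_mult_scaleR_left divide_right_mono)
    qed
    then have "expectation (\<lambda>\<omega>. rayleigh_sup ((\<sigma> / real N) *\<^sub>R S N \<omega>))
        \<le> expectation (\<lambda>\<omega>. soft_max \<phi> (\<sigma> *\<^sub>R S N \<omega>) / real N)"
      by (intro integral_mono integrable_divide_zero int_lipschitz lip continuous_rayleigh_sup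
          rayleigh_sup_lipschitz) auto
    also have "\<dots> = expectation (\<lambda>\<omega>. soft_max \<phi> (\<sigma> *\<^sub>R S N \<omega>)) / real N" by simp
    also have "\<dots> \<le> (real CARD('n) / \<phi> + real N * (\<sigma> + \<epsilon>)) / real N"
      using iter[of N] N0 by (intro divide_right_mono) auto
    also have "\<dots> = \<sigma> + (\<epsilon> + y / \<phi>)" using N0 by (simp add: y add_divide_distrib)
    finally show ?thesis by (simp add: \<phi>_def)
  qed
  \<comment> \<open>Settles the lower bound in the regime where \<open>C\<^sub>1 * y powr c\<close>
    is at least 1.\<close>
  have min_nonneg: "0 \<le> lambda_min (sample_covariance N X \<omega>)" for \<omega>
  proof -
    have "rayleigh_sup ((- 1 / real N) *\<^sub>R S N \<omega>) \<le> 0"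
      unfolding rayleigh_sup_def
    proof (rule cSUP_least)
      show "sphere 0 1 \<noteq> ({} :: (real ^ 'n) set)" by simp
      fix x :: "real ^ 'n"
      have "x \<bullet> (S N \<omega> *v x) = (\<Sum>i = 1..N. (X i \<omega> \<bullet> x)\<^sup>2)"
        by (simp add: S_def matrix_vector_mult_sum_left outer_square_mult inner_sum_right
            power2_eq_square inner_commute)
      also have "\<dots> \<ge> 0" by (intro sum_nonneg) auto
      finally show "x \<bullet> (((- 1 / real N) *\<^sub>R S N \<omega>) *v x) \<le> 0"
        using N0 by (simp add: matrix_vector_mult_scaleR_left matrix_vector_mult_uminus_left)
    qed
    then show ?thesis by (simp add: lmin)
  qed
  have min_le_max: "lambda_min (sample_covariance N X \<omega>) \<le> lambda_max (sample_covariance N X \<omega>)" for \<omega>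
  proof -
    have "transpose (sample_covariance N X \<omega>) = sample_covariance N X \<omega>"
      by (simp add: cov transpose_scaleR symS)
    then obtain v l where v: "orthonormal v" "\<And>i. sample_covariance N X \<omega> *v v i = l i *\<^sub>R v i"
      using symmetric_eigenbasis by metis
    have "Min (range l) \<le> l undefined" "l undefined \<le> Max (range l)" by auto
    then show ?thesis
      unfolding lambda_min_def lambda_max_def eigenvalues_eigenbasis[OF v] by linarith
  qed
  have y0: "0 < y" using N0 by (simp add: y)
  have "1 - C\<^sub>1 * y powr c \<le> expectation (\<lambda>\<omega>. lambda_min (sample_covariance N X \<omega>)) \<and>
    expectation (\<lambda>\<omega>. lambda_max (sample_covariance N X \<omega>)) \<le> 1 + C\<^sub>1 * (y + y powr c)"
  proof (rule optimize_scale[OF K y0 assms(4) c])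
    assume large: "1 \<le> C\<^sub>1 * y powr c" "1 < C\<^sub>1 * y"
    have "0 \<le> expectation (\<lambda>\<omega>. lambda_min (sample_covariance N X \<omega>))"
      by (rule Bochner_Integration.integral_nonneg) (rule min_nonneg)
    \<comment> \<open>With \<epsilon> equal to 1; the surplus 1 is later absorbed by
      \<open>C\<^sub>1 * y powr c\<close>.\<close>
    moreover have "expectation (\<lambda>\<omega>. lambda_max (sample_covariance N X \<omega>)) \<le> 2 + C\<^sub>1 * y"
      unfolding lmax using scaled[of 1 1] by (simp add: mult.commute)
    ultimately show ?thesis using large by (simp add: distrib_left)
  next
    fix \<epsilon> assume \<epsilon>: "0 < \<epsilon>" "\<epsilon> \<le> 1" "\<epsilon> + y / (\<epsilon> powr (1 + 2 / \<eta>) / C\<^sub>1) \<le> C\<^sub>1 * y powr c"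
    have "expectation (\<lambda>\<omega>. lambda_max (sample_covariance N X \<omega>)) \<le> 1 + C\<^sub>1 * y powr c"
      unfolding lmax using scaled[OF \<epsilon>(1,2), of 1] \<epsilon>(3) by simp
    moreover have "0 \<le> C\<^sub>1 * y" using K y0 by simp
    moreover have "1 - C\<^sub>1 * y powr c \<le> expectation (\<lambda>\<omega>. lambda_min (sample_covariance N X \<omega>))"
      unfolding lmin using scaled[OF \<epsilon>(1,2), of "- 1"] \<epsilon>(3) by simp
    ultimately show ?thesis by (simp add: distrib_left)
  qed
  moreover have "expectation (\<lambda>\<omega>. lambda_min (sample_covariance N X \<omega>))
      \<le> expectation (\<lambda>\<omega>. lambda_max (sample_covariance N X \<omega>))"
    by (intro integral_mono int_min int_max min_le_max)
  ultimately show ?thesis using int_min int_max by blast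
qed

end
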